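(* Let $n\ge 2$. Let $L(SL(n))$ be the group of smooth loops $f:S^1\to SL(n,\mathbb{C})$, $L_+(SL(n))$ the subgroup of those $f$ that extend holomorphically to $|\lambda|<1$, and $L_-(SL(n))$ the subgroup of those $f$ that extend holomorphically to $\infty\ge|\lambda|>1$ with $f(\infty)=\mathrm{I}$. Let $L$ be the subgroup of all $f\in L(SL(n))$ satisfying the $n\times n$ KdV reality condition $$\phi_n(\alpha\lambda)f(\alpha\lambda)\phi_n(\alpha\lambda)^{-1}=\phi_n(\lambda)f(\lambda)\phi_n(\lambda)^{-1},$$ let $L_\pm=L_\pm(SL(n))\cap L$, and let $\mathcal{L}$, $\mathcal{L}_\pm$ be the corresponding Lie algebras. Then $(\mathcal{L}_+,\mathcal{L}_-)$ is a splitting of $\mathcal{L}$.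
   Context: Notation: $e_{ij}$ are the elementary matrices, $\alpha=e^{2\pi i/n}$, $\sigma_k=\frac{1-\alpha^k}{1-\alpha}$, $c_k=\frac{1}{\sigma_1\cdots\sigma_k}$ ($c_0=1$), $\Lambda=\sum_{k=1}^{n-1}\sigma_k e_{k+1,k}$, and $\phi_n(\lambda)=\sum_{k=0}^{n-1}c_k\Lambda^k\lambda^k$ (a polynomial in $\lambda$ with values in unipotent lower triangular matrices). Lie algebras: $\mathcal{L}(sl(n))$ is the algebra of smooth loops $A(\lambda)=\sum_i A_i\lambda^i:S^1\to sl(n,\mathbb{C})$; $\mathcal{L}_+(sl(n))$ and $\mathcal{L}_-(sl(n))$ are the subalgebras of those $A$ with $A_i=0$ for all $i<0$, respectively for all $i\ge 0$. $\mathcal{L}$ is the subalgebra of $A\in\mathcal{L}(sl(n))$ satisfying the same reality condition $\phi_n(\alpha\lambda)A(\alpha\lambda)\phi_n(\alpha\lambda)^{-1}=\phi_n(\lambda)A(\lambda)\phi_n(\lambda)^{-1}$ (equivalently, $\phi_n(\lambda)A(\lambda)\phi_n(\lambda)^{-1}$ is a power series in $\lambda^n$, with positive and negative powers allowed), and $\mathcal{L}_\pm=\mathcal{L}\cap\mathcal{L}_\pm(sl(n))$. Splitting: for a group $L$ with Lie algebra $\mathcal{L}$ and subgroups $L_\pm$ with Lie subalgebras $\mathcal{L}_\pm$, the pair $(\mathcal{L}_+,\mathcal{L}_-)$ is called a splitting of $\mathcal{L}$ if $\mathcal{L}=\mathcal{L}_++\mathcal{L}_-$ is a direct sum of linear subspaces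 and $L_+\cap L_-=\{e\}$. *)

theory Defs
  imports "HOL-Complex_Analysis.Complex_Analysis" "HOL-Algebra.AbelCoset"
    "Jordan_Normal_Form.Determinant"
begin

hide_const (open) Determinants.det Finite_Cartesian_Product.mat

section \<open>Lie algebras and splittings\<close>

text \<open>A Lie algebra over \<open>R\<close> is encoded as an \<open>R\<close>-module record whose field \<^const>\<open>mult\<close>
  (written \<open>\<otimes>\<close>) is the bracket; the field \<^const>\<open>one\<close> plays no role.\<close>

locale lie_algebra = module R M for R (structure) and M (structure) +
  assumes bracket_closed:
      "\<lbrakk>x \<in> carrier M; y \<in> carrier M\<rbrakk> \<Longrightarrow> x \<otimes>\<^bsub>M\<^esub> y \<in> carrier M"
    and bracket_add_left:
      "\<lbrakk>x \<in> carrier M; y \<in> carrier M; z \<in> carrier M\<rbrakk>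
       \<Longrightarrow> (x \<oplus>\<^bsub>M\<^esub> y) \<otimes>\<^bsub>M\<^esub> z = (x \<otimes>\<^bsub>M\<^esub> z) \<oplus>\<^bsub>M\<^esub> (y \<otimes>\<^bsub>M\<^esub> z)"
    and bracket_smult_left:
      "\<lbrakk>a \<in> carrier R; x \<in> carrier M; y \<in> carrier M\<rbrakk>
       \<Longrightarrow> (a \<odot>\<^bsub>M\<^esub> x) \<otimes>\<^bsub>M\<^esub> y = a \<odot>\<^bsub>M\<^esub> (x \<otimes>\<^bsub>M\<^esub> y)"
    and bracket_add_right:
      "\<lbrakk>x \<in> carrier M; y \<in> carrier M; z \<in> carrier M\<rbrakk>
       \<Longrightarrow> x \<otimes>\<^bsub>M\<^esub> (y \<oplus>\<^bsub>M\<^esub> z) = (x \<otimes>\<^bsub>M\<^esub> y) \<oplus>\<^bsub>M\<^esub> (x \<otimes>\<^bsub>M\<^esub> z)"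
    and bracket_smult_right:
      "\<lbrakk>a \<in> carrier R; x \<in> carrier M; y \<in> carrier M\<rbrakk>
       \<Longrightarrow> x \<otimes>\<^bsub>M\<^esub> (a \<odot>\<^bsub>M\<^esub> y) = a \<odot>\<^bsub>M\<^esub> (x \<otimes>\<^bsub>M\<^esub> y)"
    and bracket_self:
      "x \<in> carrier M \<Longrightarrow> x \<otimes>\<^bsub>M\<^esub> x = \<zero>\<^bsub>M\<^esub>"
    and jacobi:
      "\<lbrakk>x \<in> carrier M; y \<in> carrier M; z \<in> carrier M\<rbrakk>
       \<Longrightarrow> (x \<otimes>\<^bsub>M\<^esub> (y \<otimes>\<^bsub>M\<^esub> z)) \<oplus>\<^bsub>M\<^esub> (y \<otimes>\<^bsub>M\<^esub> (z \<otimes>\<^bsub>M\<^esub> x)) \<oplus>\<^bsub>M\<^esub> (z \<otimes>\<^bsub>M\<^esub> (x \<otimes>\<^bsub>M\<^esub> y)) = \<zero>\<^bsub>M\<^esub>"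

definition lie_subalgebra :: "'v set \<Rightarrow> 'r ring \<Rightarrow> ('r, 'v) module \<Rightarrow> bool" where
  "lie_subalgebra H R M \<longleftrightarrow>
     submodule H R M \<and> (\<forall>x\<in>H. \<forall>y\<in>H. x \<otimes>\<^bsub>M\<^esub> y \<in> H)"

definition splitting ::
  "'r ring \<Rightarrow> 'g monoid \<Rightarrow> 'g set \<Rightarrow> 'g set \<Rightarrow> ('r, 'v) module \<Rightarrow> 'v set \<Rightarrow> 'v set \<Rightarrow> bool"
where
  "splitting R L Lp Lm LL LLp LLm \<longleftrightarrow>
     group L \<and> subgroup Lp L \<and> subgroup Lm L \<and>
     lie_algebra R LL \<and> lie_subalgebra LLp R LL \<and> lie_subalgebra LLm R LL \<and>
     carrier LL = set_add LL LLp LLm \<and> LLp \<inter> LLm = {\<zero>\<^bsub>LL\<^esub>} \<and>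
     Lp \<inter> Lm = {\<one>\<^bsub>L\<^esub>}"

definition complex_ring :: "complex ring" where
  "complex_ring = \<lparr>carrier = UNIV, mult = (*), one = 1, zero = 0, add = (+)\<rparr>"


section \<open>Smooth matrix-valued loops\<close>

text \<open>A loop is a function on the unit circle, represented by an extensional function, that is,
  one that is \<^const>\<open>undefined\<close> off the circle. In this way equality of loops is
  equality of functions.\<close>

abbreviation circle :: "complex set" where
  "circle \<equiv> sphere 0 1"

definition smooth_on_circle :: "(complex \<Rightarrow> complex) \<Rightarrow> bool" where
  "smooth_on_circle g \<longleftrightarrow>
     (\<exists>D :: nat \<Rightarrow> real \<Rightarrow> complex. (\<forall>t. D 0 t = g (cis t)) \<and>
        (\<forall>k t. (D k has_vector_derivative D (Suc k) t) (at t)))"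

definition smooth_loops :: "nat \<Rightarrow> (complex \<Rightarrow> complex mat) set" where
  "smooth_loops n =
     {f \<in> circle \<rightarrow>\<^sub>E carrier_mat n n. \<forall>i<n. \<forall>j<n. smooth_on_circle (\<lambda>z. f z $$ (i, j))}"


section \<open>The loop group of SL(n)\<close>

definition loop_SL :: "nat \<Rightarrow> (complex \<Rightarrow> complex mat) monoid" where
  "loop_SL n =
     \<lparr>carrier = {f \<in> smooth_loops n. \<forall>z\<in>circle. Determinant.det (f z) = 1},
      mult = (\<lambda>f g. \<lambda>z\<in>circle. f z * g z),
      one = (\<lambda>z\<in>circle. 1\<^sub>m n)\<rparr>"

text \<open>\<open>F\<close> is continuous on the closed unit disc and holomorphic in its interior.\<close>

definition disc_holomorphic :: "nat \<Rightarrow> (complex \<Rightarrow> complex mat) \<Rightarrow> bool" where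
  "disc_holomorphic n F \<longleftrightarrow>
     (\<forall>w\<in>cball 0 1. F w \<in> carrier_mat n n) \<and>
     (\<forall>i<n. \<forall>j<n. continuous_on (cball 0 1) (\<lambda>w. F w $$ (i, j)) \<and>
        (\<lambda>w. F w $$ (i, j)) holomorphic_on ball 0 1)"

definition loop_SL_plus :: "nat \<Rightarrow> (complex \<Rightarrow> complex mat) set" where
  "loop_SL_plus n =
     {f \<in> carrier (loop_SL n). \<exists>F. disc_holomorphic n F \<and> (\<forall>z\<in>circle. f z = F z)}"

text \<open>The extension to the outer region including infinity is expressed in the chart
  \<open>w = 1/\<lambda>\<close>, which identifies that region with the unit disc and infinity with \<open>w = 0\<close>.\<close>

definition loop_SL_minus :: "nat \<Rightarrow> (complex \<Rightarrow> complex mat) set" where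
  "loop_SL_minus n =
     {f \<in> carrier (loop_SL n). \<exists>F. disc_holomorphic n F \<and> F 0 = 1\<^sub>m n \<and>
        (\<forall>z\<in>circle. f z = F (1 / z))}"


section \<open>The loop algebra of sl(n)\<close>

definition mat_trace :: "complex mat \<Rightarrow> complex" where
  "mat_trace A = (\<Sum>i<dim_row A. A $$ (i, i))"

definition loop_sl :: "nat \<Rightarrow> (complex, complex \<Rightarrow> complex mat) module" where
  "loop_sl n =
     \<lparr>carrier = {A \<in> smooth_loops n. \<forall>z\<in>circle. mat_trace (A z) = 0},
      mult = (\<lambda>A B. \<lambda>z\<in>circle. A z * B z - B z * A z),
      one = undefined,
      zero = (\<lambda>z\<in>circle. 0\<^sub>m n n),
      add = (\<lambda>A B. \<lambda>z\<in>circle. A z + B z),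
      smult = (\<lambda>a A. \<lambda>z\<in>circle. a \<cdot>\<^sub>m A z)\<rparr>"

text \<open>The coefficient \<open>A\<^sub>i\<close> in the expansion \<open>A(\<lambda>) = \<Sum>\<^sub>i A\<^sub>i \<lambda>\<^sup>i\<close>, given by Fourier's formula.\<close>

definition loop_coeff :: "nat \<Rightarrow> (complex \<Rightarrow> complex mat) \<Rightarrow> int \<Rightarrow> complex mat" where
  "loop_coeff n A i = mat n n (\<lambda>(a, b).
     integral {0..2 * pi} (\<lambda>t. A (cis t) $$ (a, b) * cis (- (of_int i * t)))
       / complex_of_real (2 * pi))"

definition loop_sl_plus :: "nat \<Rightarrow> (complex \<Rightarrow> complex mat) set" where
  "loop_sl_plus n = {A \<in> carrier (loop_sl n). \<forall>i<0. loop_coeff n A i = 0\<^sub>m n n}"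

definition loop_sl_minus :: "nat \<Rightarrow> (complex \<Rightarrow> complex mat) set" where
  "loop_sl_minus n = {A \<in> carrier (loop_sl n). \<forall>i\<ge>0. loop_coeff n A i = 0\<^sub>m n n}"


section \<open>The KdV reality condition\<close>

definition kdv_alpha :: "nat \<Rightarrow> complex" where
  "kdv_alpha n = exp (2 * of_real pi * \<i> / of_nat n)"

definition kdv_sigma :: "nat \<Rightarrow> nat \<Rightarrow> complex" where
  "kdv_sigma n k = (1 - kdv_alpha n ^ k) / (1 - kdv_alpha n)"

definition kdv_c :: "nat \<Rightarrow> nat \<Rightarrow> complex" where
  "kdv_c n k = 1 / (\<Prod>j=1..k. kdv_sigma n j)"

text \<open>Matrix indices start at 0, so \<open>e\<^sub>k\<^sub>+\<^sub>1\<^sub>,\<^sub>k\<close> has its entry in row \<open>k\<close> and column \<open>k - 1\<close>.\<close>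

definition kdv_Lambda :: "nat \<Rightarrow> complex mat" where
  "kdv_Lambda n = mat n n (\<lambda>(i, j). if i = j + 1 then kdv_sigma n i else 0)"

definition kdv_phi :: "nat \<Rightarrow> complex \<Rightarrow> complex mat" where
  "kdv_phi n z = mat n n (\<lambda>(i, j). \<Sum>k<n. kdv_c n k * (kdv_Lambda n ^\<^sub>m k) $$ (i, j) * z ^ k)"

text \<open>The inverse is taken in the matrix ring; \<open>kdv_phi n z\<close> is unipotent, hence invertible.\<close>

definition mat_inv :: "nat \<Rightarrow> complex mat \<Rightarrow> complex mat" where
  "mat_inv n A = inv\<^bsub>ring_mat TYPE(complex) n ()\<^esub> A"

definition kdv_conj :: "nat \<Rightarrow> (complex \<Rightarrow> complex mat) \<Rightarrow> complex \<Rightarrow> complex mat" where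
  "kdv_conj n f z = kdv_phi n z * f z * mat_inv n (kdv_phi n z)"

definition kdv_reality :: "nat \<Rightarrow> (complex \<Rightarrow> complex mat) \<Rightarrow> bool" where
  "kdv_reality n f \<longleftrightarrow> (\<forall>z\<in>circle. kdv_conj n f (kdv_alpha n * z) = kdv_conj n f z)"

definition KdV_group :: "nat \<Rightarrow> (complex \<Rightarrow> complex mat) monoid" where
  "KdV_group n = (loop_SL n)\<lparr>carrier := {f \<in> carrier (loop_SL n). kdv_reality n f}\<rparr>"

definition KdV_group_plus :: "nat \<Rightarrow> (complex \<Rightarrow> complex mat) set" where
  "KdV_group_plus n = loop_SL_plus n \<inter> carrier (KdV_group n)"

definition KdV_group_minus :: "nat \<Rightarrow> (complex \<Rightarrow> complex mat) set" where
  "KdV_group_minus n = loop_SL_minus n \<inter> carrier (KdV_group n)"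

definition KdV_algebra :: "nat \<Rightarrow> (complex, complex \<Rightarrow> complex mat) module" where
  "KdV_algebra n = (loop_sl n)\<lparr>carrier := {A \<in> carrier (loop_sl n). kdv_reality n A}\<rparr>"

definition KdV_algebra_plus :: "nat \<Rightarrow> (complex \<Rightarrow> complex mat) set" where
  "KdV_algebra_plus n = carrier (KdV_algebra n) \<inter> loop_sl_plus n"

definition KdV_algebra_minus :: "nat \<Rightarrow> (complex \<Rightarrow> complex mat) set" where
  "KdV_algebra_minus n = carrier (KdV_algebra n) \<inter> loop_sl_minus n"

end

theory Submission
  imports Defs
begin

text \<open>Put \<open>N(z) = 1 - (1 - \<alpha>) z \<Lambda>\<close>. The polynomial \<open>\<phi>\<close> is a truncated q-exponential at \<open>q = \<alpha>\<close>, hence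
  \<open>\<phi>(\<alpha>z) = \<phi>(z) N(z)\<close>, and the reality condition becomes the intertwining relation
  \<open>N(z) A(\<alpha>z) = A(z) N(z)\<close>. In Fourier coefficients this reads
  \<open>(\<alpha>\<^sup>i - 1) A\<^sub>i = (1 - \<alpha>) (\<alpha>\<^sup>i\<^sup>-\<^sup>1 \<Lambda> A\<^sub>i\<^sub>-\<^sub>1 - A\<^sub>i\<^sub>-\<^sub>1 \<Lambda>)\<close>. The left-hand side vanishes at \<open>i = 0\<close>, so
  the relation splits into one for the coefficients with \<open>i \<ge> 0\<close> and one for those with \<open>i < 0\<close>: the
  usual projection onto nonnegative powers preserves the reality condition. The intersections
  are trivial by the uniqueness of Fourier coefficients.\<close>


section \<open>Smooth functions on the circle\<close>

text \<open>Both \<phi> and its inverse are polynomials of degree up to \<open>n - 1\<close> in z,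
  so conjugation by \<phi> couples a coefficient of A with many others, and truncating A seems to
  leave boundary terms near the cut. The quotient of \<phi>(\<alpha>z) by \<phi>(z) has degree one:
  only neighbouring coefficients are coupled, and just one relation, the one at i = 0, straddles the
  cut. It constrains the coefficient at -1 alone and reads 0 = 0 after truncation. The factor N
  comes from q-calculus: \<open>kdv_sigma n k\<close> is the q-integer [k] at q = \<alpha> and
  \<open>kdv_c n k\<close> is the inverse q-factorial. Comparing the terms of degree k leaves
  \<open>kdv_c n k * kdv_sigma n k = kdv_c n (k - 1)\<close>. Stopping at degree
  \<open>n - 1\<close> does no harm because the n-th power of \<Lambda> is zero. The analytic
  obstacle is that the truncated series has to be smooth again. This rests on the rapid decay of the
  Fourier coefficients of smooth functions. That coefficients determine a function is obtained from
  Stone-Weierstrass.\<close>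

definition smooth_line :: "(real \<Rightarrow> complex) set" where
  "smooth_line = {u. \<exists>D :: nat \<Rightarrow> real \<Rightarrow> complex. D 0 = u \<and>
     (\<forall>k t. (D k has_vector_derivative D (Suc k) t) (at t))}"

lemma smooth_on_circle_iff: "smooth_on_circle g \<longleftrightarrow> (\<lambda>t. g (cis t)) \<in> smooth_line"
  unfolding smooth_on_circle_def smooth_line_def by (auto simp: fun_eq_iff)

lemma smooth_lineE:
  assumes "u \<in> smooth_line"
  obtains u' where "u' \<in> smooth_line" "\<And>t. (u has_vector_derivative u' t) (at t)"
proof -
  obtain D where D: "D 0 = u" "\<And>k t. (D k has_vector_derivative D (Suc k) t) (at t)"
    using assms unfolding smooth_line_def by auto
  have "D 1 \<in> smooth_line"
    unfolding smooth_line_def by (intro CollectI exI[of _ "\<lambda>k. D (Suc k)"]) (simp add: D)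
  then show thesis
    using that[of "D 1"] D(2)[of 0] D(1) by simp
qed

text \<open>Smoothness behaves as a greatest fixed point: choose a derivative inside S for every
  member of S and iterate the choice. Closure properties then need only first derivatives and no
  formula for the k-th one.\<close>

lemma smooth_line_coinduct:
  assumes "u \<in> S"
    and S: "\<And>v. v \<in> S \<Longrightarrow> \<exists>v'\<in>S. \<forall>t. (v has_vector_derivative v' t) (at t)"
  shows "u \<in> smooth_line"
proof -
  obtain d where d: "\<And>v. v \<in> S \<Longrightarrow> d v \<in> S"
    "\<And>v t. v \<in> S \<Longrightarrow> (v has_vector_derivative d v t) (at t)"
    using S by metis
  have "(d ^^ k) u \<in> S" for k
    by (induction k) (simp_all add: assms(1) d(1))
  then show ?thesis
    unfolding smooth_line_def by (intro CollectI exI[of _ "\<lambda>k. (d ^^ k) u"]) (simp add: d(2))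
qed

lemma smooth_line_const: "(\<lambda>_. c) \<in> smooth_line"
  by (rule smooth_line_coinduct[of _ "range (\<lambda>c _. c)"]) (auto intro!: derivative_eq_intros)

lemma smooth_line_add:
  assumes "u \<in> smooth_line" "v \<in> smooth_line"
  shows "(\<lambda>t. u t + v t) \<in> smooth_line"
proof (rule smooth_line_coinduct[of _ "{\<lambda>t. u t + v t |u v. u \<in> smooth_line \<and> v \<in> smooth_line}"])
  fix w assume "w \<in> {\<lambda>t. u t + v t |u v. u \<in> smooth_line \<and> v \<in> smooth_line}"
  then obtain u v where w: "w = (\<lambda>t. u t + v t)" "u \<in> smooth_line" "v \<in> smooth_line"
    by blast
  obtain u' where "u' \<in> smooth_line" "\<And>t. (u has_vector_derivative u' t) (at t)"
    using smooth_lineE[OF w(2)] by blast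
  moreover obtain v' where "v' \<in> smooth_line" "\<And>t. (v has_vector_derivative v' t) (at t)"
    using smooth_lineE[OF w(3)] by blast
  ultimately show "\<exists>w'\<in>{\<lambda>t. u t + v t |u v. u \<in> smooth_line \<and> v \<in> smooth_line}.
      \<forall>t. (w has_vector_derivative w' t) (at t)"
    unfolding w(1) by (intro bexI[of _ "\<lambda>t. u' t + v' t"]) (auto intro: has_vector_derivative_add)
qed (use assms in blast)

text \<open>The Leibniz rule leads from products to sums of products. This closure is the smallest
  family to which the coinduction principle applies when a product is differentiated.\<close>

inductive_set product_sums :: "(real \<Rightarrow> complex) set" where
  mult: "\<lbrakk>u \<in> smooth_line; v \<in> smooth_line\<rbrakk> \<Longrightarrow> (\<lambda>t. u t * v t) \<in> product_sums"
| add: "\<lbrakk>u \<in> product_sums; v \<in> product_sums\<rbrakk> \<Longrightarrow> (\<lambda>t. u t + v t) \<in> product_sums"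

lemma smooth_line_mult:
  assumes "u \<in> smooth_line" "v \<in> smooth_line"
  shows "(\<lambda>t. u t * v t) \<in> smooth_line"
proof (rule smooth_line_coinduct[of _ product_sums])
  fix w assume "w \<in> product_sums"
  then show "\<exists>w'\<in>product_sums. \<forall>t. (w has_vector_derivative w' t) (at t)"
  proof induction
    case (mult u v)
    obtain u' where "u' \<in> smooth_line" "\<And>t. (u has_vector_derivative u' t) (at t)"
      using smooth_lineE[OF mult(1)] by blast
    moreover obtain v' where "v' \<in> smooth_line" "\<And>t. (v has_vector_derivative v' t) (at t)"
      using smooth_lineE[OF mult(2)] by blast
    ultimately show ?case
      using mult
      by (intro bexI[of _ "\<lambda>t. u t * v' t + u' t * v t"])
         (auto intro: has_vector_derivative_mult product_sums.intros)
  next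
    case (add u v)
    then obtain u' v' where "u' \<in> product_sums" "\<And>t. (u has_vector_derivative u' t) (at t)"
      "v' \<in> product_sums" "\<And>t. (v has_vector_derivative v' t) (at t)"
      by blast
    then show ?case
      by (intro bexI[of _ "\<lambda>t. u' t + v' t"])
         (auto intro: has_vector_derivative_add product_sums.add)
  qed
qed (use assms in \<open>blast intro: product_sums.mult\<close>)

lemma smooth_line_affine:
  assumes "u \<in> smooth_line"
  shows "(\<lambda>t. u (r * t + s)) \<in> smooth_line"
\<comment> \<open>The chain rule produces a factor r at each differentiation, so the family has to
  admit real multiples; the given function is the case c = 1.\<close>
proof (rule smooth_line_coinduct[of _ "{\<lambda>t. of_real c * u (r * t + s) |c u. u \<in> smooth_line}"])
  fix w assume "w \<in> {\<lambda>t. of_real c * u (r * t + s) |c u. u \<in> smooth_line}"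
  then obtain c u where w: "w = (\<lambda>t. of_real c * u (r * t + s))" "u \<in> smooth_line"
    by blast
  obtain u' where u': "u' \<in> smooth_line" "\<And>t. (u has_vector_derivative u' t) (at t)"
    using smooth_lineE[OF w(2)] by blast
  have "((\<lambda>t. u (r * t + s)) has_vector_derivative r *\<^sub>R u' (r * t + s)) (at t)" for t
  proof -
    have "((\<lambda>t. r * t + s) has_vector_derivative r) (at t)"
      by (auto intro!: derivative_eq_intros)
    then show ?thesis
      using vector_diff_chain_at[OF _ u'(2)] by (simp add: o_def)
  qed
  then have "(w has_vector_derivative of_real (c * r) * u' (r * t + s)) (at t)" for t
    unfolding w(1)
    by (auto intro!: derivative_eq_intros simp: scaleR_conv_of_real)
  then show "\<exists>w'\<in>{\<lambda>t. of_real c * u (r * t + s) |c u. u \<in> smooth_line}.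
      \<forall>t. (w has_vector_derivative w' t) (at t)"
    using u'(1) by (intro bexI[of _ "\<lambda>t. of_real (c * r) * u' (r * t + s)"]) blast+
qed (use assms in \<open>force intro: exI[of _ 1]\<close>)

lemma smooth_on_circle_cong:
  assumes "smooth_on_circle f" "\<And>z. z \<in> circle \<Longrightarrow> f z = g z"
  shows "smooth_on_circle g"
  using assms by (simp add: smooth_on_circle_iff)

lemma smooth_on_circle_const: "smooth_on_circle (\<lambda>_. c)"
  by (simp add: smooth_on_circle_iff smooth_line_const)

lemma smooth_on_circle_add:
  "\<lbrakk>smooth_on_circle f; smooth_on_circle g\<rbrakk> \<Longrightarrow> smooth_on_circle (\<lambda>z. f z + g z)"
  by (simp add: smooth_on_circle_iff smooth_line_add)

lemma smooth_on_circle_mult: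
  "\<lbrakk>smooth_on_circle f; smooth_on_circle g\<rbrakk> \<Longrightarrow> smooth_on_circle (\<lambda>z. f z * g z)"
  by (simp add: smooth_on_circle_iff smooth_line_mult)

lemma smooth_on_circle_diff:
  assumes "smooth_on_circle f" "smooth_on_circle g"
  shows "smooth_on_circle (\<lambda>z. f z - g z)"
  using smooth_on_circle_add[OF assms(1) smooth_on_circle_mult[OF smooth_on_circle_const[of "-1"] assms(2)]]
  by simp

lemma smooth_on_circle_rotate:
  assumes "smooth_on_circle f" "a \<in> circle"
  shows "smooth_on_circle (\<lambda>z. f (a * z))"
proof -
  obtain s where "a = cis s"
    using assms(2) by (metis complex_norm_eq_1_exp_eq cis_conv_exp mem_sphere_0)
  then show ?thesis
    using smooth_line_affine[of "\<lambda>t. f (cis t)" 1 s] assms(1)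
    by (simp add: smooth_on_circle_iff cis_mult add.commute)
qed

lemma smooth_on_circle_cnj:
  assumes "smooth_on_circle f"
  shows "smooth_on_circle (\<lambda>z. f (cnj z))"
  using smooth_line_affine[of "\<lambda>t. f (cis t)" "-1" 0] assms
  by (simp add: smooth_on_circle_iff cis_cnj)

text \<open>Smoothness speaks only about g composed with \<open>cis\<close>, so continuity on the
  circle requires a continuous local inverse of \<open>cis\<close>: \<open>Arg\<close> away from the
  negative real axis, and the branch \<open>Arg (- w) + pi\<close> around the point -1.\<close>

lemma smooth_on_circle_imp_continuous_on:
  assumes "smooth_on_circle g"
  shows "continuous_on circle g"
proof -
  obtain u' where "\<And>t. ((\<lambda>t. g (cis t)) has_vector_derivative u' t) (at t)"
    by (rule smooth_lineE[OF assms[unfolded smooth_on_circle_iff]]) (rule that)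
  then have c: "isCont (\<lambda>t. g (cis t)) t" for t
    by (rule has_vector_derivative_continuous)
  have "continuous (at z within circle) g" if z: "z \<in> circle" for z
  proof (cases "z \<in> \<real>\<^sub>\<le>\<^sub>0")
    case False
    have "isCont (\<lambda>w. g (cis (Arg w))) z"
      by (rule isCont_o2[OF continuous_at_Arg[OF False] c])
    moreover have "cis (Arg w) = w" if "w \<in> circle" for w
      using that cis_Arg[of w] by (cases "w = 0") (simp_all add: sgn_div_norm)
    ultimately show ?thesis
      using continuous_transform_within[of z circle "\<lambda>w. g (cis (Arg w))" 1 g] z
      by (simp add: continuous_at_imp_continuous_within)
  next
    case True
    then have "-z \<notin> \<real>\<^sub>\<le>\<^sub>0"
      using z by (cases "z = 0") (auto simp: complex_nonpos_Reals_iff complex_eq_iff)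
    then have "isCont (\<lambda>w. Arg (- w)) z"
      by (intro isCont_o2[where f = uminus and g = Arg] continuous_at_Arg) simp_all
    then have "isCont (\<lambda>w. Arg (- w) + pi) z"
      by (rule continuous_add) simp
    then have "isCont (\<lambda>w. g (cis (Arg (-w) + pi))) z"
      by (rule isCont_o2) (rule c)
    moreover have "cis (Arg (-w) + pi) = w" if "w \<in> circle" for w
      using that cis_Arg[of "-w"] by (cases "w = 0") (simp_all add: cis_mult[symmetric] sgn_div_norm)
    ultimately show ?thesis
      using continuous_transform_within[of z circle "\<lambda>w. g (cis (Arg (-w) + pi))" 1 g] z
      by (simp add: continuous_at_imp_continuous_within)
  qed
  then show ?thesis
    by (simp add: continuous_on_eq_continuous_within)
qed

lemma continuous_on_cis_comp:
  assumes "continuous_on circle g"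
  shows "continuous_on T (\<lambda>t. g (cis t))"
  by (rule continuous_on_compose2[OF assms]) (auto intro!: continuous_intros)


section \<open>Fourier coefficients\<close>

definition fourier_coeff :: "(complex \<Rightarrow> complex) \<Rightarrow> int \<Rightarrow> complex" where
  "fourier_coeff g k =
     integral {0..2 * pi} (\<lambda>t. g (cis t) * cis (- (of_int k * t))) / complex_of_real (2 * pi)"

lemma loop_coeff_eq: "loop_coeff n A i = mat n n (\<lambda>(a, b). fourier_coeff (\<lambda>z. A z $$ (a, b)) i)"
  by (simp add: loop_coeff_def fourier_coeff_def)

lemma fourier_integrable:
  assumes "continuous_on circle g"
  shows "(\<lambda>t. g (cis t) * cis (- (of_int k * t))) integrable_on {0..2 * pi}"
  by (intro integrable_continuous_real continuous_intros continuous_on_cis_comp assms)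

lemma norm_fourier_coeff_le:
  assumes "continuous_on circle g" "\<And>z. z \<in> circle \<Longrightarrow> norm (g z) \<le> B"
  shows "norm (fourier_coeff g k) \<le> B"
proof -
  have "norm (integral {0..2 * pi} (\<lambda>t. g (cis t) * cis (- (of_int k * t)))) \<le> B * (2 * pi - 0)"
  proof (rule integral_bound)
    show "continuous_on {0..2 * pi} (\<lambda>t. g (cis t) * cis (- (of_int k * t)))"
      by (intro continuous_intros continuous_on_cis_comp assms)
  qed (use assms(2) in \<open>auto simp: norm_mult\<close>)
  then show ?thesis
    by (simp add: fourier_coeff_def norm_divide field_simps)
qed

lemma fourier_coeff_cong:
  assumes "\<And>z. z \<in> circle \<Longrightarrow> f z = g z"
  shows "fourier_coeff f k = fourier_coeff g k"
  using assms by (simp add: fourier_coeff_def)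

lemma fourier_coeff_add:
  assumes "continuous_on circle f" "continuous_on circle g"
  shows "fourier_coeff (\<lambda>z. f z + g z) k = fourier_coeff f k + fourier_coeff g k"
  using Henstock_Kurzweil_Integration.integral_add[OF assms[THEN fourier_integrable]]
  by (simp add: fourier_coeff_def algebra_simps add_divide_distrib)

lemma fourier_coeff_cmult: "fourier_coeff (\<lambda>z. c * f z) k = c * fourier_coeff f k"
  by (simp add: fourier_coeff_def mult.assoc)

lemma fourier_coeff_diff:
  assumes "continuous_on circle f" "continuous_on circle g"
  shows "fourier_coeff (\<lambda>z. f z - g z) k = fourier_coeff f k - fourier_coeff g k"
  using fourier_coeff_add[OF assms(1), of "\<lambda>z. -1 * g z" k] assms(2)
  by (simp only: fourier_coeff_cmult) (simp add: continuous_on_minus)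

lemma fourier_coeff_shift:
  "fourier_coeff (\<lambda>z. z * g z) k = fourier_coeff g (k - 1)"
proof -
  have "cis t * g (cis t) * cis (- (of_int k * t)) = g (cis t) * cis (- (of_int (k - 1) * t))" for t
    by (simp add: mult.commute[of "cis t"] mult.assoc cis_mult) (simp add: algebra_simps)
  then show ?thesis
    by (simp only: fourier_coeff_def)
qed

lemma fourier_coeff_power_mult:
  "fourier_coeff (\<lambda>z. z ^ m * g z) k = fourier_coeff g (k - int m)"
  by (induction m arbitrary: k) (simp_all add: mult.assoc fourier_coeff_shift algebra_simps)

lemma fourier_coeff_const: "fourier_coeff (\<lambda>_. c) k = (if k = 0 then c else 0)"
proof (cases "k = 0")
  case False
  have "((\<lambda>t. cis (- (of_int k * t))) has_integral
      \<i> / of_int k * cis (- (of_int k * (2 * pi))) - \<i> / of_int k * cis (- (of_int k * 0))) {0..2 * pi}"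
    by (rule fundamental_theorem_of_calculus)
       (use False in \<open>auto simp: cis_conv_exp field_simps intro!: derivative_eq_intros
         has_vector_derivative_real_field\<close>)
  moreover have "cis (- (of_int k * (2 * pi))) = 1"
    using cis_multiple_2pi[of "- of_int k"] by (simp add: mult.commute)
  ultimately show ?thesis
    using False by (simp add: fourier_coeff_def integral_unique)
qed (simp add: fourier_coeff_def scaleR_conv_of_real)

text \<open>Translation moves the domain to \<open>{s..p + s}\<close>; the part beyond p is carried
  back by one period and fills the missing \<open>{0..s}\<close>.\<close>

lemma integral_periodic_shift:
  fixes h :: "real \<Rightarrow> complex"
  assumes h: "continuous_on UNIV h" "\<And>t. h (t + p) = h t" and s: "0 \<le> s" "s \<le> p"
  shows "integral {0..p} (\<lambda>t. h (t + s)) = integral {0..p} h"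
proof -
  have i: "h integrable_on {a..b}" for a b
    by (rule integrable_continuous_real) (rule continuous_on_subset[OF h(1)], simp)
  have "integral {0..p} (\<lambda>t. h (t + s)) = integral {s..p + s} h"
    using integral_shift_real_ivl[of s s "p + s" h] by simp
  also have "\<dots> = integral {s..p} h + integral {p..p + s} h"
    using s by (intro Henstock_Kurzweil_Integration.integral_combine[symmetric] i) auto
  also have "integral {p..p + s} h = integral {0..s} h"
    using integral_shift_real_ivl[of p p "p + s" h] h(2) by simp
  also have "integral {s..p} h + integral {0..s} h = integral {0..p} h"
    using s by (subst add.commute, intro Henstock_Kurzweil_Integration.integral_combine i) auto
  finally show ?thesis .
qed

lemma cis_periodic: "cis (t + 2 * pi) = cis t"
  by (simp add: cis_mult[symmetric])

lemma cis_int_periodic: "cis (- (of_int k * (t + 2 * pi))) = cis (- (of_int k * t))"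
proof -
  have "cis (- (of_int k * (t + 2 * pi))) = cis (- (of_int k * t)) * cis (2 * pi * (- of_int k))"
    by (simp add: cis_mult algebra_simps)
  then show ?thesis
    using cis_multiple_2pi[of "- of_int k"] by simp
qed

lemma fourier_coeff_rotate:
  assumes g: "continuous_on circle g" and s: "0 \<le> s" "s \<le> 2 * pi"
  shows "fourier_coeff (\<lambda>z. g (cis s * z)) k = cis (of_int k * s) * fourier_coeff g k"
proof -
  define h where "h t = g (cis t) * cis (- (of_int k * t))" for t
  have c: "continuous_on UNIV h"
    unfolding h_def by (intro continuous_intros continuous_on_cis_comp g)
  have p: "h (t + 2 * pi) = h t" for t
    by (simp only: h_def cis_periodic cis_int_periodic)
  have "g (cis s * cis t) * cis (- (of_int k * t)) = cis (of_int k * s) * h (t + s)" for t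
    by (simp add: h_def cis_mult mult.left_commute[of "cis (of_int k * s)"])
       (simp add: algebra_simps)
  then show ?thesis
    using integral_periodic_shift[OF c p s] by (simp add: fourier_coeff_def h_def)
qed

text \<open>On the circle conjugation is inversion, so it exchanges positive and negative
  frequencies. This transfers results between the two halves and handles the chart
  \<open>1 / z\<close> at infinity.\<close>

lemma fourier_coeff_cnj:
  assumes g: "continuous_on circle g"
  shows "fourier_coeff (\<lambda>z. g (cnj z)) k = fourier_coeff g (- k)"
proof -
  define h where "h t = g (cis t) * cis (of_int k * t)" for t
  have c: "continuous_on T h" for T
    unfolding h_def by (intro continuous_intros continuous_on_cis_comp g)
  have p: "h (t + 2 * pi) = h t" for t
    using cis_int_periodic[of "-k" t] by (simp add: h_def cis_periodic)
  have "integral {0..2 * pi} (\<lambda>t. h (- t)) = integral {- (2 * pi)..0} h"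
    using Henstock_Kurzweil_Integration.integral_reflect_real[of "2 * pi" 0 "\<lambda>t. h (- t)"] by simp
  also have "\<dots> = integral {0..2 * pi} h"
    using integral_shift_real_ivl[of 0 "2 * pi" "2 * pi" "\<lambda>t. h (t - 2 * pi)"] p[of "_ - 2 * pi"]
    by simp
  finally show ?thesis
    unfolding fourier_coeff_def h_def by (simp add: cis_cnj)
qed


section \<open>Uniqueness of Fourier coefficients\<close>

text \<open>A real-linear function is a combination of z and \<open>cnj z\<close>. On the circle,
  multiplication by these shifts the coefficients by one place in opposite directions, which
  preserves the vanishing of all of them.\<close>

lemma fourier_coeff_bounded_linear_mult:
  fixes p :: "complex \<Rightarrow> real"
  assumes f: "continuous_on circle f" "\<And>k. fourier_coeff f k = 0" and p: "bounded_linear p"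
  shows "fourier_coeff (\<lambda>z. of_real (p z) * f z) k = 0"
proof -
  interpret bounded_linear p by fact
  \<comment> \<open>These are the Wirtinger derivatives of p with respect to z and
    \<open>cnj z\<close>.\<close>
  define b where "b = (of_real (p 1) - \<i> * of_real (p \<i>)) / 2"
  define c where "c = (of_real (p 1) + \<i> * of_real (p \<i>)) / 2"
  have "of_real (p z) = b * z + c * cnj z" for z
  proof -
    have "p z = Re z * p 1 + Im z * p \<i>"
      using add[of "of_real (Re z)" "\<i> * of_real (Im z)"] scaleR[of "Re z" 1] scaleR[of "Im z" \<i>]
      by (simp add: scaleR_conv_of_real mult.commute complex_eq[symmetric])
    then show ?thesis
      by (simp add: b_def c_def complex_eq_iff field_simps)
  qed
  then have eq: "of_real (p z) * f z = b * (z * f z) + c * (cnj z * f z)" for z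
    by (simp add: algebra_simps)
  have "fourier_coeff (\<lambda>z. cnj z * f z) k = fourier_coeff (\<lambda>z. z * (cnj z * f z)) (k + 1)" for k
    by (simp only: fourier_coeff_shift) simp
  also have "fourier_coeff (\<lambda>z. z * (cnj z * f z)) k = fourier_coeff f k" for k
    by (rule fourier_coeff_cong) (simp add: mult.assoc[symmetric] complex_norm_square[symmetric])
  finally have "fourier_coeff (\<lambda>z. cnj z * f z) k = 0" for k
    by (simp add: f(2))
  then show ?thesis
    unfolding eq
    by (subst fourier_coeff_add)
       (auto intro!: continuous_intros f(1) simp: fourier_coeff_cmult fourier_coeff_shift f(2))
qed

text \<open>The assumption on f reproduces itself under multiplication. In the product case the
  induction hypothesis for p is applied to q f in place of f, hence f is kept arbitrary.\<close>

lemma fourier_coeff_real_polynomial_mult: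
  assumes "real_polynomial_function p" "continuous_on circle f" "\<And>k. fourier_coeff f k = 0"
  shows "fourier_coeff (\<lambda>z. of_real (p z) * f z) k = 0"
  using assms
proof (induction arbitrary: f k)
  case (linear p)
  then show ?case by (simp add: fourier_coeff_bounded_linear_mult)
next
  case (const c)
  then show ?case by (simp add: fourier_coeff_cmult)
next
  case (add p q)
  have "continuous_on circle p" "continuous_on circle q"
    using add.hyps continuous_real_polymonial_function
    by (auto intro!: continuous_at_imp_continuous_on)
  then show ?case
    using add by (simp add: distrib_right fourier_coeff_add continuous_intros)
next
  case (mult p q)
  have "continuous_on circle q"
    using mult.hyps continuous_real_polymonial_function
    by (auto intro!: continuous_at_imp_continuous_on)
  then have "fourier_coeff (\<lambda>z. of_real (p z) * (of_real (q z) * f z)) k = 0"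
    by (intro mult.IH(1)) (auto intro!: continuous_intros mult.prems mult.IH(2))
  then show ?case
    by (simp add: mult.assoc)
qed

lemma fourier_coeff_polynomial_mult:
  fixes p :: "complex \<Rightarrow> complex"
  assumes p: "polynomial_function p" and f: "continuous_on circle f" "\<And>k. fourier_coeff f k = 0"
  shows "fourier_coeff (\<lambda>z. p z * f z) k = 0"
proof -
  have p: "real_polynomial_function (\<lambda>z. Re (p z))" "real_polynomial_function (\<lambda>z. Im (p z))"
    using p by (auto simp: polynomial_function_iff_Basis_inner Basis_complex_def)
  have c: "continuous_on circle (\<lambda>z. of_real (q z) * f z)" if "real_polynomial_function q" for q
    using that by (intro continuous_intros f(1))
      (auto intro!: continuous_at_imp_continuous_on continuous_real_polymonial_function)
  have eq: "p z * f z = of_real (Re (p z)) * f z + \<i> * (of_real (Im (p z)) * f z)" for z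
    by (simp add: complex_eq_iff)
  show ?thesis
    unfolding eq
    by (simp add: fourier_coeff_add fourier_coeff_cmult c p continuous_on_mult_left
        fourier_coeff_real_polynomial_mult[OF _ f])
qed

text \<open>Stone-Weierstrass yields a polynomial p close to \<open>cnj f\<close>. Since
  \<open>p * f\<close> has zeroth coefficient 0, the mean value of the squared modulus of f is
  arbitrarily small, hence 0, and a continuous nonnegative function with integral 0
  vanishes.\<close>

lemma fourier_coeff_unique:
  assumes f: "continuous_on circle f" "\<And>k. fourier_coeff f k = 0" and z: "z \<in> circle"
  shows "f z = 0"
proof -
  obtain B where B: "\<And>z. z \<in> circle \<Longrightarrow> norm (f z) \<le> B" "B > 0"
  proof -
    have "bounded (f ` circle)"
      by (intro compact_imp_bounded compact_continuous_image f(1) compact_sphere)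
    then obtain B where "B > 0" "\<forall>x\<in>f ` circle. norm x \<le> B"
      unfolding bounded_pos by blast
    then show thesis
      using that by blast
  qed
  define h where "h z = cnj (f z) * f z" for z
  have h: "h z = of_real ((norm (f z))\<^sup>2)" for z
    by (metis complex_norm_square h_def mult.commute)
  have hc: "continuous_on circle h"
    unfolding h_def by (intro continuous_intros f(1))
  have "norm (fourier_coeff h 0) \<le> e" if e: "e > 0" for e
  proof -
    \<comment> \<open>The tolerance \<open>e / B\<close> compensates for the later factor f, whose
      norm is at most B.\<close>
    obtain p where p: "polynomial_function p" "\<And>z. z \<in> circle \<Longrightarrow> norm (cnj (f z) - p z) < e / B"
      using Stone_Weierstrass_polynomial_function[of circle "\<lambda>z. cnj (f z)" "e / B"] f(1) e B(2)
      by (auto intro: continuous_intros)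
    have pc: "continuous_on circle p"
      using p(1) continuous_on_polymonial_function by blast
    have "fourier_coeff h 0 = fourier_coeff (\<lambda>z. h z - p z * f z) 0"
      using fourier_coeff_polynomial_mult[OF p(1) f, of 0]
      by (subst fourier_coeff_diff) (auto intro!: continuous_intros hc pc f(1))
    also have "norm \<dots> \<le> e"
    proof -
      have "norm (h z - p z * f z) \<le> e" if "z \<in> circle" for z
      proof -
        have "norm (h z - p z * f z) = norm (cnj (f z) - p z) * norm (f z)"
          by (simp add: h_def left_diff_distrib flip: norm_mult)
        also have "\<dots> \<le> e / B * B"
          using p(2)[OF that] B(1)[OF that] e B(2) by (intro mult_mono) auto
        finally show ?thesis
          using B(2) by simp
      qed
      then show ?thesis
        by (intro norm_fourier_coeff_le) (auto intro!: continuous_intros hc pc f(1))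
    qed
    finally show ?thesis .
  qed
  then have "fourier_coeff h 0 = 0"
    by (metis dense_ge norm_le_zero_iff)
  then have "integral {0..2 * pi} (\<lambda>t. of_real ((norm (f (cis t)))\<^sup>2)) = (0::complex)"
    by (simp add: fourier_coeff_def h)
  moreover have "(\<lambda>t. complex_of_real ((norm (f (cis t)))\<^sup>2)) integrable_on {0..2 * pi}"
    by (intro integrable_continuous_real continuous_intros continuous_on_cis_comp f(1))
  from integral_linear[OF this bounded_linear_Re]
  have "integral {0..2 * pi} (\<lambda>t. (norm (f (cis t)))\<^sup>2)
      = Re (integral {0..2 * pi} (\<lambda>t. complex_of_real ((norm (f (cis t)))\<^sup>2)))"
    unfolding o_def Re_complex_of_real .
  ultimately have I: "integral (cbox 0 (2 * pi)) (\<lambda>t. (norm (f (cis t)))\<^sup>2) = 0"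
    by simp
  have c: "continuous_on (cbox 0 (2 * pi)) (\<lambda>t. (norm (f (cis t)))\<^sup>2)"
    by (intro continuous_intros continuous_on_cis_comp f(1))
  obtain t where t: "t \<in> cbox 0 (2 * pi)" "z = cis t"
  proof -
    have "z = cis (Arg2pi z)"
      using z Arg2pi_eq[of z] by (auto simp: cis_conv_exp)
    then show thesis
      using that[of "Arg2pi z"] Arg2pi_ge_0[of z] Arg2pi_lt_2pi[of z] by (simp add: less_imp_le)
  qed
  have "(norm (f (cis t)))\<^sup>2 = 0"
    using t(1) c I
    by (intro has_integral_0_cbox_imp_0[of 0 "2 * pi" "\<lambda>t. (norm (f (cis t)))\<^sup>2"])
       (auto simp: has_integral_iff integrable_continuous_real not_le)
  then show ?thesis
    by (simp add: t(2))
qed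


section \<open>Decay of Fourier coefficients and the analytic projection\<close>

lemma has_vector_derivative_cis_mult:
  "((\<lambda>t. cis (r * t)) has_vector_derivative \<i> * of_real r * cis (r * t)) (at t within S)"
  unfolding has_vector_derivative_def
  by (auto intro!: derivative_eq_intros simp: scaleR_conv_of_real)

text \<open>Integration by parts; \<open>u (2 * pi) = u 0\<close> makes the boundary terms
  cancel.\<close>

lemma integral_derivative_cis:
  fixes u :: "real \<Rightarrow> complex"
  assumes u: "\<And>t. (u has_vector_derivative u' t) (at t)" and u': "continuous_on UNIV u'"
    and p: "u (2 * pi) = u 0"
  shows "integral {0..2 * pi} (\<lambda>t. u' t * cis (- (of_int k * t))) =
    \<i> * of_int k * integral {0..2 * pi} (\<lambda>t. u t * cis (- (of_int k * t)))"
proof -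
  have uc: "continuous_on T u" for T
    by (intro continuous_at_imp_continuous_on ballI has_vector_derivative_continuous[OF u])
  have u'c: "continuous_on T u'" for T
    using u' by (rule continuous_on_subset) simp
  define e where "e t = cis (- of_int k * t)" for t
  define c where "c = \<i> * of_real (- of_int k)"
  have ec: "continuous_on T e" for T
    unfolding e_def by (intro continuous_intros)
  have i: "(\<lambda>t. c * (u t * e t)) integrable_on {0..2 * pi}"
    "(\<lambda>t. u' t * e t) integrable_on {0..2 * pi}"
    by (rule integrable_continuous_real, intro continuous_on_mult continuous_on_const uc u'c ec)+
  have e: "(e has_vector_derivative c * e t) (at t)" for t
    unfolding e_def c_def by (rule has_vector_derivative_cis_mult)
  have "((\<lambda>t. u t * e t) has_vector_derivative c * (u t * e t) + u' t * e t)
      (at t within {0..2 * pi})" for t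
    using has_vector_derivative_at_within[OF has_vector_derivative_mult[OF u e]]
    by (simp only: mult.left_commute)
  then have "((\<lambda>t. c * (u t * e t) + u' t * e t) has_integral
      u (2 * pi) * e (2 * pi) - u 0 * e 0) {0..2 * pi}"
    by (intro fundamental_theorem_of_calculus) simp_all
  moreover have "e (2 * pi) = e 0"
    using cis_multiple_2pi[of "- of_int k"] by (simp add: e_def mult.commute)
  ultimately have "integral {0..2 * pi} (\<lambda>t. c * (u t * e t) + u' t * e t) = 0"
    using p by (intro integral_unique) simp
  then have "c * integral {0..2 * pi} (\<lambda>t. u t * e t) + integral {0..2 * pi} (\<lambda>t. u' t * e t) = 0"
    using Henstock_Kurzweil_Integration.integral_add[OF i] by simp
  from minus_unique[OF this] show ?thesis
    by (simp add: c_def e_def)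
qed

text \<open>The m-th derivative multiplies the k-th coefficient by
  \<open>(\<i> * of_int k) ^ m\<close>, and the coefficients of that derivative are bounded by its
  supremum over one period.\<close>

lemma fourier_coeff_decay:
  assumes "smooth_on_circle g"
  obtains B where "\<And>k. \<bar>of_int k\<bar> ^ m * norm (fourier_coeff g k) \<le> B"
proof -
  obtain D where D: "\<And>t. D 0 t = g (cis t)"
    "\<And>j t. (D j has_vector_derivative D (Suc j) t) (at t)"
    using assms unfolding smooth_on_circle_def by blast
  have cont: "continuous_on T (D j)" for j T
    by (intro continuous_at_imp_continuous_on ballI has_vector_derivative_continuous[OF D(2)])
  \<comment> \<open>The derivatives are given only as functions on the line. Their periodicity,
    which removes the boundary terms, passes from D j to D (Suc j) by uniqueness of
    derivatives.\<close>
  have periodic: "D j (t + 2 * pi) = D j t" for j t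
  proof (induction j arbitrary: t)
    case (Suc j)
    have "((\<lambda>s. D j (s + 2 * pi)) has_vector_derivative D (Suc j) (t + 2 * pi)) (at t)"
    proof -
      have "((\<lambda>s. s + 2 * pi) has_vector_derivative 1) (at t)"
        by (auto intro!: derivative_eq_intros)
      from vector_diff_chain_at[OF this D(2)] show ?thesis
        by (simp add: o_def)
    qed
    then have "(D j has_vector_derivative D (Suc j) (t + 2 * pi)) (at t)"
      unfolding Suc.IH .
    then show ?case
      by (rule vector_derivative_unique_at) (rule D(2))
  qed (simp only: D(1) cis_periodic)
  define I where "I j k = integral {0..2 * pi} (\<lambda>t. D j t * cis (- (of_int k * t)))" for j k
  have "I j k = (\<i> * of_int k) ^ j * I 0 k" for j k
  proof (induction j)
    case (Suc j)
    have "I (Suc j) k = \<i> * of_int k * I j k"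
      unfolding I_def using periodic[of j 0] by (intro integral_derivative_cis D(2) cont) simp
    then show ?case
      by (simp add: Suc)
  qed simp
  from this[of m] have I: "norm (I m k) = \<bar>of_int k\<bar> ^ m * norm (I 0 k)" for k
    using norm_mult[of "(\<i> * of_int k) ^ m" "I 0 k"] by (simp only: norm_power norm_mult) simp
  have "bounded (D m ` {0..2 * pi})"
    by (intro compact_imp_bounded compact_continuous_image cont compact_Icc)
  then obtain B where B: "B > 0" "\<forall>x\<in>D m ` {0..2 * pi}. norm x \<le> B"
    unfolding bounded_pos by blast
  have "norm (I m k) \<le> B * (2 * pi - 0)" for k
    unfolding I_def
  proof (rule integral_bound)
    show "continuous_on {0..2 * pi} (\<lambda>t. D m t * cis (- (of_int k * t)))"
      by (intro continuous_intros cont)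
  qed (use B in \<open>auto simp: norm_mult\<close>)
  then have "norm (I m k) / (2 * pi) \<le> B" for k
    by (simp add: field_simps)
  moreover have "norm (fourier_coeff g k) = norm (I 0 k) / (2 * pi)" for k
    by (simp add: fourier_coeff_def I_def D norm_divide)
  ultimately have "\<bar>of_int k\<bar> ^ m * norm (fourier_coeff g k) \<le> B" for k
    by (simp add: I)
  then show thesis
    by (rule that)
qed

lemma fourier_coeff_summable:
  assumes "smooth_on_circle g"
  shows "summable (\<lambda>k. real k ^ m * norm (fourier_coeff g (int k)))"
proof -
  \<comment> \<open>Two powers beyond m leave the convergent series of the inverse squares as a
    majorant.\<close>
  obtain B where B: "\<And>k. \<bar>of_int k\<bar> ^ (m + 2) * norm (fourier_coeff g k) \<le> B"
    using fourier_coeff_decay[OF assms] by blast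
  have "norm (real k ^ m * norm (fourier_coeff g (int k))) \<le> B * inverse (real k ^ 2)" if "k \<ge> 1" for k
    using B[of "int k"] that by (simp add: field_simps power_add power2_eq_square)
  moreover have "summable (\<lambda>k. B * inverse (real k ^ 2))"
    by (intro summable_mult inverse_power_summable) simp
  ultimately show ?thesis
    by (rule summable_comparison_test'[rotated])
qed

text \<open>Termwise differentiation: the second summability assumption is the Weierstrass majorant
  for the differentiated series, which therefore converges uniformly on the whole line.\<close>

lemma power_series_has_vector_derivative:
  fixes a :: "nat \<Rightarrow> complex"
  assumes "summable (\<lambda>k. norm (a k))" "summable (\<lambda>k. real k * norm (a k))"
  shows "((\<lambda>t. \<Sum>k. a k * cis t ^ k) has_vector_derivative
    (\<Sum>k. \<i> * of_nat k * a k * cis t ^ k)) (at t)"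
proof -
  define f' where "f' k t = \<i> * of_nat k * a k * cis t ^ k" for k t
  define F' where "F' t = (\<Sum>k. f' k t)" for t
  have sums: "(\<lambda>k. a k * cis t ^ k) sums (\<Sum>k. a k * cis t ^ k)" for t
    by (intro summable_sums summable_norm_cancel[OF summable_comparison_test'[OF assms(1)]])
       (simp add: norm_mult norm_power)
  have unif: "uniform_limit UNIV (\<lambda>n t. \<Sum>i<n. f' i t) F' sequentially"
    unfolding F'_def
    by (rule Weierstrass_m_test[OF _ assms(2)]) (simp add: f'_def norm_mult norm_power)
  have "\<exists>g. \<forall>t\<in>UNIV. (\<lambda>k. a k * cis t ^ k) sums g t \<and>
      (g has_derivative (\<lambda>h. h *\<^sub>R F' t)) (at t within UNIV)"
  proof (rule has_derivative_series[where f' = "\<lambda>k t h. h *\<^sub>R f' k t"])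
    show "((\<lambda>t. a k * cis t ^ k) has_derivative (\<lambda>h. h *\<^sub>R f' k t)) (at t within UNIV)" for k t
      using has_vector_derivative_mult_right[OF has_vector_derivative_cis_mult[of "real k" t UNIV], of "a k"]
      by (simp add: has_vector_derivative_def f'_def Complex.DeMoivre mult_ac)
    show "\<forall>\<^sub>F n in sequentially. \<forall>t\<in>UNIV. \<forall>h.
        norm ((\<Sum>k<n. h *\<^sub>R f' k t) - h *\<^sub>R F' t) \<le> e * norm h" if "e > 0" for e
      using uniform_limitD[OF unif that]
    proof eventually_elim
      case (elim n)
      have "norm ((\<Sum>k<n. h *\<^sub>R f' k t) - h *\<^sub>R F' t) = \<bar>h\<bar> * norm ((\<Sum>k<n. f' k t) - F' t)" for h t
        by (simp flip: scaleR_sum_right scaleR_diff_right)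
      moreover have "\<bar>h\<bar> * norm ((\<Sum>k<n. f' k t) - F' t) \<le> \<bar>h\<bar> * e" for h t
        using elim by (intro mult_left_mono) (auto simp: dist_norm less_imp_le)
      ultimately show ?case
        by (simp add: mult.commute)
    qed
  qed (use sums in auto)
  then obtain g where g: "\<And>t. (\<lambda>k. a k * cis t ^ k) sums g t"
    "\<And>t. (g has_vector_derivative F' t) (at t)"
    by (auto simp: has_vector_derivative_def)
  have "g = (\<lambda>t. \<Sum>k. a k * cis t ^ k)"
    using g(1) by (auto simp: sums_iff)
  then show ?thesis
    using g(2) by (simp add: F'_def f'_def)
qed

lemma smooth_on_circle_power_series:
  fixes a :: "nat \<Rightarrow> complex"
  assumes "\<And>m. summable (\<lambda>k. real k ^ m * norm (a k))"
  shows "smooth_on_circle (\<lambda>z. \<Sum>k. a k * z ^ k)"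
  unfolding smooth_on_circle_def
proof (intro exI[of _ "\<lambda>m t. \<Sum>k. (\<i> * of_nat k) ^ m * a k * cis t ^ k"] conjI allI)
  fix m t
  have "summable (\<lambda>k. norm ((\<i> * of_nat k) ^ m * a k))"
    using assms[of m] by (simp add: norm_mult norm_power)
  moreover have "summable (\<lambda>k. real k * norm ((\<i> * of_nat k) ^ m * a k))"
    using assms[of "Suc m"] by (simp add: norm_mult norm_power mult.assoc)
  ultimately show "((\<lambda>t. \<Sum>k. (\<i> * of_nat k) ^ m * a k * cis t ^ k) has_vector_derivative
      (\<Sum>k. (\<i> * of_nat k) ^ Suc m * a k * cis t ^ k)) (at t)"
    using power_series_has_vector_derivative[of "\<lambda>k. (\<i> * of_nat k) ^ m * a k"]
    by (simp add: mult.assoc)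
qed simp

text \<open>A one-sided convolution formula. Absolute convergence of the power series makes the
  integrand converge uniformly, so sum and integral may be exchanged. With g = 1 it computes the
  coefficients of a truncated series; for general g it shows that products respect vanishing below
  an index.\<close>

lemma fourier_coeff_power_series_mult:
  fixes a :: "nat \<Rightarrow> complex"
  assumes a: "summable (\<lambda>k. norm (a k))" and g: "continuous_on circle g"
  shows "(\<lambda>k. a k * fourier_coeff g (i - int k)) sums
    fourier_coeff (\<lambda>z. (\<Sum>k. a k * z ^ k) * g z) i"
proof -
  define e where "e t = cis (- (of_int i * t))" for t
  define f where "f k t = a k * cis t ^ k * g (cis t) * e t" for k t
  obtain B where B: "\<And>z. z \<in> circle \<Longrightarrow> norm (g z) \<le> B"
  proof -
    have "bounded (g ` circle)"
      by (intro compact_imp_bounded compact_continuous_image g compact_sphere)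
    then obtain B where "\<forall>x\<in>g ` circle. norm x \<le> B"
      unfolding bounded_iff by blast
    then show thesis
      using that by blast
  qed
  have u: "uniform_limit {0..2 * pi} (\<lambda>n t. \<Sum>k<n. f k t) (\<lambda>t. \<Sum>k. f k t) sequentially"
  proof (rule Weierstrass_m_test[where M = "\<lambda>k. norm (a k) * B"])
    show "norm (f k t) \<le> norm (a k) * B" for k t
      unfolding f_def e_def by (simp add: norm_mult norm_power mult_left_mono B)
  qed (rule summable_mult2[OF a])
  have fc: "continuous_on {0..2 * pi} (f k)" for k
    unfolding f_def e_def by (intro continuous_intros continuous_on_cis_comp g)
  then have "continuous_on {0..2 * pi} (\<lambda>t. \<Sum>k<n. f k t)" for n
    by (intro continuous_intros)
  from u this have "\<exists>I J. (\<forall>n. ((\<lambda>t. \<Sum>k<n. f k t) has_integral I n) {0..2 * pi}) \<and>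
      ((\<lambda>t. \<Sum>k. f k t) has_integral J) {0..2 * pi} \<and> I \<longlonglongrightarrow> J"
    by (rule uniform_limit_integral[OF _ _ trivial_limit_sequentially]) (intro exI conjI allI)
  then obtain I J where IJ: "\<forall>n. ((\<lambda>t. \<Sum>k<n. f k t) has_integral I n) {0..2 * pi}"
    "((\<lambda>t. \<Sum>k. f k t) has_integral J) {0..2 * pi}" "I \<longlonglongrightarrow> J"
    by (elim exE conjE) (rule that)
  have "I n = (\<Sum>k<n. integral {0..2 * pi} (f k))" for n
    using spec[OF IJ(1), of n] Henstock_Kurzweil_Integration.integral_sum[of "{..<n}" f "{0..2 * pi}"]
      integrable_continuous_real[OF fc] by (simp add: integral_unique)
  then have "I = (\<lambda>n. \<Sum>k<n. integral {0..2 * pi} (f k))"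
    by blast
  with IJ(3) have "(\<lambda>k. integral {0..2 * pi} (f k)) sums J"
    by (simp add: sums_def)
  then have *: "(\<lambda>k. integral {0..2 * pi} (f k) / of_real (2 * pi)) sums (J / of_real (2 * pi))"
    by (rule sums_divide)
  have "integral {0..2 * pi} (f k) / of_real (2 * pi) = a k * fourier_coeff g (i - int k)" for k
  proof -
    have "a k * fourier_coeff g (i - int k) = fourier_coeff (\<lambda>z. a k * (z ^ k * g z)) i"
      unfolding fourier_coeff_cmult fourier_coeff_power_mult ..
    also have "\<dots> = integral {0..2 * pi} (f k) / of_real (2 * pi)"
      unfolding fourier_coeff_def f_def e_def by (simp only: mult.assoc)
    finally show ?thesis ..
  qed
  moreover have "(\<Sum>k. f k t) = (\<Sum>k. a k * cis t ^ k) * g (cis t) * e t" for t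
  proof -
    have "summable (\<lambda>k. a k * cis t ^ k)"
      by (rule summable_norm_cancel) (simp add: norm_mult norm_power a)
    from suminf_mult2[OF this, of "g (cis t) * e t"] show ?thesis
      by (simp add: f_def mult.assoc)
  qed
  then have "J / of_real (2 * pi) = fourier_coeff (\<lambda>z. (\<Sum>k. a k * z ^ k) * g z) i"
    using IJ(2) by (simp add: fourier_coeff_def e_def has_integral_iff)
  ultimately show ?thesis
    using * by simp
qed

text \<open>This is the Szego projection onto nonnegative frequencies.\<close>

definition fourier_plus :: "(complex \<Rightarrow> complex) \<Rightarrow> complex \<Rightarrow> complex" where
  "fourier_plus g z = (\<Sum>k. fourier_coeff g (int k) * z ^ k)"

lemma summable_fourier_plus:
  assumes "smooth_on_circle g" "z \<in> circle"
  shows "summable (\<lambda>k. fourier_coeff g (int k) * z ^ k)"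
  using fourier_coeff_summable[OF assms(1), of 0] assms(2)
  by (auto intro!: summable_norm_cancel[where f = "\<lambda>k. fourier_coeff g (int k) * z ^ k"]
      simp: norm_mult norm_power)

lemma smooth_fourier_plus: "smooth_on_circle g \<Longrightarrow> smooth_on_circle (fourier_plus g)"
  unfolding fourier_plus_def
  by (intro smooth_on_circle_power_series fourier_coeff_summable)

lemma fourier_coeff_fourier_plus_mult:
  assumes "smooth_on_circle f" "continuous_on circle g"
  shows "(\<lambda>k. fourier_coeff f (int k) * fourier_coeff g (i - int k)) sums
    fourier_coeff (\<lambda>z. fourier_plus f z * g z) i"
  using fourier_coeff_power_series_mult[OF _ assms(2), of "\<lambda>k. fourier_coeff f (int k)" i]
    fourier_coeff_summable[OF assms(1), of 0] by (simp add: fourier_plus_def)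

lemma fourier_coeff_fourier_plus:
  assumes "smooth_on_circle f"
  shows "fourier_coeff (fourier_plus f) i = (if i \<ge> 0 then fourier_coeff f i else 0)"
proof -
  have "(\<lambda>k. fourier_coeff f (int k) * fourier_coeff (\<lambda>_. 1) (i - int k)) sums
      fourier_coeff (fourier_plus f) i"
    using fourier_coeff_fourier_plus_mult[OF assms, of "\<lambda>_. 1" i] by simp
  \<comment> \<open>For negative i the index \<open>nat i\<close> is 0, and the inner conditional
    supplies the value 0 there; this is right because \<open>i - int 0\<close> is then
    nonzero.\<close>
  moreover have "fourier_coeff f (int k) * fourier_coeff (\<lambda>_. 1) (i - int k) =
      (if k = nat i then (if i \<ge> 0 then fourier_coeff f i else 0) else 0)" for k
  proof -
    consider "k = nat i" "i \<ge> 0" | "k = nat i" "i < 0" | "k \<noteq> nat i" "i - int k \<noteq> 0"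
      by linarith
    then show ?thesis
      by cases (simp_all add: fourier_coeff_const)
  qed
  ultimately have "(\<lambda>k. if k = nat i then (if i \<ge> 0 then fourier_coeff f i else 0) else 0) sums
      fourier_coeff (fourier_plus f) i"
    by (simp only:)
  from sums_unique2[OF this sums_single] show ?thesis .
qed

lemma fourier_plus_eqI:
  assumes f: "smooth_on_circle f" "\<And>i. i < 0 \<Longrightarrow> fourier_coeff f i = 0" and z: "z \<in> circle"
  shows "fourier_plus f z = f z"
proof -
  note c = smooth_on_circle_imp_continuous_on[OF f(1)]
    smooth_on_circle_imp_continuous_on[OF smooth_fourier_plus[OF f(1)]]
  have "fourier_plus f z - f z = 0"
    by (rule fourier_coeff_unique[OF _ _ z])
       (auto intro!: continuous_intros c simp: fourier_coeff_diff c fourier_coeff_fourier_plus f)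
  then show ?thesis
    by simp
qed

text \<open>Here f is its own power series, so the convolution formula meets only coefficients of g
  at indices at most i, all of which vanish. The bound m is a parameter since the nonnegative half
  uses m = 0 and the reflected negative half uses m = 1.\<close>

lemma fourier_coeff_mult_eq_0:
  assumes f: "smooth_on_circle f" "\<And>i. i < 0 \<Longrightarrow> fourier_coeff f i = 0"
    and g: "smooth_on_circle g" "\<And>i. i < m \<Longrightarrow> fourier_coeff g i = 0" and i: "i < m"
  shows "fourier_coeff (\<lambda>z. f z * g z) i = 0"
proof -
  have "(\<lambda>k. fourier_coeff f (int k) * fourier_coeff g (i - int k)) sums
      fourier_coeff (\<lambda>z. fourier_plus f z * g z) i"
    by (intro fourier_coeff_fourier_plus_mult f smooth_on_circle_imp_continuous_on g)
  moreover have "fourier_coeff g (i - int k) = 0" for k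
    using i by (intro g) simp
  ultimately have "fourier_coeff (\<lambda>z. fourier_plus f z * g z) i = 0"
    by (simp add: sums_iff)
  moreover have "fourier_coeff (\<lambda>z. fourier_plus f z * g z) i = fourier_coeff (\<lambda>z. f z * g z) i"
    by (intro fourier_coeff_cong) (simp add: fourier_plus_eqI f)
  ultimately show ?thesis
    by simp
qed

text \<open>Reflection by \<open>cnj\<close> turns vanishing at all i \<ge> 0 into vanishing at all
  i \<le> 0, that is, below 1.\<close>

lemma fourier_coeff_mult_eq_0':
  assumes f: "smooth_on_circle f" "\<And>i. i \<ge> 0 \<Longrightarrow> fourier_coeff f i = 0"
    and g: "smooth_on_circle g" "\<And>i. i \<ge> 0 \<Longrightarrow> fourier_coeff g i = 0" and i: "i \<ge> 0"
  shows "fourier_coeff (\<lambda>z. f z * g z) i = 0"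
proof -
  note c = smooth_on_circle_imp_continuous_on
  have "fourier_coeff (\<lambda>z. f (cnj z) * g (cnj z)) (- i) = 0"
    by (rule fourier_coeff_mult_eq_0[where m = 1, OF smooth_on_circle_cnj[OF f(1)] _
          smooth_on_circle_cnj[OF g(1)]])
       (use i in \<open>simp_all add: fourier_coeff_cnj[OF c[OF f(1)]] fourier_coeff_cnj[OF c[OF g(1)]] f(2) g(2)\<close>)
  then show ?thesis
    using fourier_coeff_cnj[OF c[OF smooth_on_circle_mult[OF f(1) g(1)]], of "- i"] by simp
qed

lemma fourier_plus_add:
  assumes "smooth_on_circle f" "smooth_on_circle g" "z \<in> circle"
  shows "fourier_plus (\<lambda>z. f z + g z) z = fourier_plus f z + fourier_plus g z"
  using assms by (simp add: fourier_plus_def fourier_coeff_add smooth_on_circle_imp_continuous_on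
      distrib_right suminf_add summable_fourier_plus)

lemma fourier_plus_cmult:
  assumes "smooth_on_circle f" "z \<in> circle"
  shows "fourier_plus (\<lambda>z. c * f z) z = c * fourier_plus f z"
  using assms by (simp add: fourier_plus_def fourier_coeff_cmult mult.assoc suminf_mult summable_fourier_plus)

lemma fourier_plus_diff:
  assumes "smooth_on_circle f" "smooth_on_circle g" "z \<in> circle"
  shows "fourier_plus (\<lambda>z. f z - g z) z = fourier_plus f z - fourier_plus g z"
  using assms by (simp add: fourier_plus_def fourier_coeff_diff smooth_on_circle_imp_continuous_on
      left_diff_distrib suminf_diff summable_fourier_plus)

lemma fourier_plus_sum:
  assumes "\<And>i. i \<in> I \<Longrightarrow> smooth_on_circle (f i)" "z \<in> circle"
  shows "fourier_plus (\<lambda>z. \<Sum>i\<in>I. f i z) z = (\<Sum>i\<in>I. fourier_plus (f i) z)"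
proof -
  have "smooth_on_circle (\<lambda>z. \<Sum>i\<in>I. f i z) \<and> ?thesis"
    using assms(1)
  proof (induction I rule: infinite_finite_induct)
    case (insert i I)
    then show ?case
      using fourier_plus_add[of "f i" "\<lambda>z. \<Sum>i\<in>I. f i z", OF _ _ assms(2)]
      by (simp add: smooth_on_circle_add)
  qed (auto simp: smooth_on_circle_const fourier_plus_def fourier_coeff_const)
  then show ?thesis ..
qed

lemma fourier_plus_rotate:
  assumes "continuous_on circle g" "0 \<le> s" "s \<le> 2 * pi"
  shows "fourier_plus (\<lambda>z. g (cis s * z)) z = fourier_plus g (cis s * z)"
  unfolding fourier_plus_def fourier_coeff_rotate[OF assms]
  by (simp add: power_mult_distrib Complex.DeMoivre mult.assoc mult.left_commute[of "cis _"])

text \<open>Multiplication by z moves the coefficient of g at -1 across the cut. The projection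
  commutes with it exactly when this coefficient is 0, which is what
  \<open>fourier_coeff f 0 = 0\<close> expresses.\<close>

lemma fourier_plus_shift:
  assumes g: "smooth_on_circle g" and z: "z \<in> circle"
    and f: "\<And>z. z \<in> circle \<Longrightarrow> f z = z * g z" "fourier_coeff f 0 = 0"
  shows "fourier_plus f z = z * fourier_plus g z"
proof -
  have c: "fourier_coeff f i = fourier_coeff g (i - 1)" for i
    using fourier_coeff_cong[OF f(1)] by (simp add: fourier_coeff_shift)
  have "(\<lambda>k. z * (fourier_coeff g (int k) * z ^ k)) sums (z * fourier_plus g z)"
    using summable_fourier_plus[OF g z] unfolding fourier_plus_def by (intro sums_mult summable_sums)
  then have "(\<lambda>k. fourier_coeff f (int (Suc k)) * z ^ Suc k) sums (z * fourier_plus g z)"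
    by (simp add: c mult_ac)
  \<comment> \<open>The shifted series starts at degree 1; the missing term of degree 0 is the
    vanishing coefficient of f.\<close>
  then have "(\<lambda>k. fourier_coeff f (int k) * z ^ k) sums (z * fourier_plus g z + 0)"
    using f(2) by (subst (asm) sums_Suc_iff) simp
  then show ?thesis
    by (simp add: fourier_plus_def sums_iff)
qed


section \<open>Boundary values of holomorphic functions\<close>

text \<open>Cauchy's integral formula at the origin for F(z) times the k-th power of z, in the
  version that asks only for continuity up to the boundary.\<close>

lemma fourier_coeff_holomorphic:
  assumes c: "continuous_on (cball 0 1) F" and h: "F holomorphic_on ball 0 1"
  shows "fourier_coeff F (- int k) = (if k = 0 then F 0 else 0)"
proof -
  define H where "H z = F z * z ^ k" for z
  have "((\<lambda>u. H u / (u - 0)) has_contour_integral (2 * of_real pi * \<i> * H 0)) (circlepath 0 1)"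
    unfolding H_def
    by (rule Cauchy_integral_circlepath) (auto intro!: continuous_intros holomorphic_intros c h)
  then have "((\<lambda>t. H (cis t) / cis t * \<i> * cis t) has_integral 2 * of_real pi * \<i> * H 0) {0..2 * pi}"
    unfolding circlepath_def by (subst (asm) has_contour_integral_part_circlepath_iff) auto
  then have "((\<lambda>t. - \<i> * (H (cis t) / cis t * \<i> * cis t)) has_integral
      - \<i> * (2 * of_real pi * \<i> * H 0)) {0..2 * pi}"
    by (rule has_integral_mult_right)
  then have "((\<lambda>t. F (cis t) * cis (- (of_int (- int k) * t))) has_integral 2 * of_real pi * H 0) {0..2 * pi}"
    by (simp add: H_def Complex.DeMoivre mult_ac)
  then show ?thesis
    by (auto simp: fourier_coeff_def has_integral_iff H_def)
qed


section \<open>Matrices over algebras of functions\<close>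

text \<open>Used for smooth functions on the circle and for functions continuous on the closed disc
  and holomorphic inside. Products, determinants and adjugates are polynomial in the entries, so one
  argument covers both classes; \<open>cong\<close> is assumed because only values on X
  matter.\<close>

locale function_algebra =
  fixes X :: "'x set" and S :: "('x \<Rightarrow> complex) set"
  assumes const: "(\<lambda>_. c) \<in> S"
    and add: "\<lbrakk>f \<in> S; g \<in> S\<rbrakk> \<Longrightarrow> (\<lambda>x. f x + g x) \<in> S"
    and mult: "\<lbrakk>f \<in> S; g \<in> S\<rbrakk> \<Longrightarrow> (\<lambda>x. f x * g x) \<in> S"
    and cong: "\<lbrakk>f \<in> S; \<And>x. x \<in> X \<Longrightarrow> f x = g x\<rbrakk> \<Longrightarrow> g \<in> S"
begin

definition matrices :: "nat \<Rightarrow> ('x \<Rightarrow> complex mat) set" where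
  "matrices n = {A. (\<forall>x\<in>X. A x \<in> carrier_mat n n) \<and> (\<forall>i<n. \<forall>j<n. (\<lambda>x. A x $$ (i, j)) \<in> S)}"

lemma sum: "(\<And>i. i \<in> I \<Longrightarrow> f i \<in> S) \<Longrightarrow> (\<lambda>x. \<Sum>i\<in>I. f i x) \<in> S"
  by (induction I rule: infinite_finite_induct) (simp_all add: const add)

lemma prod: "(\<And>i. i \<in> I \<Longrightarrow> f i \<in> S) \<Longrightarrow> (\<lambda>x. \<Prod>i\<in>I. f i x) \<in> S"
  by (induction I rule: infinite_finite_induct) (simp_all add: const mult)

lemma matrices_carrier: "\<lbrakk>A \<in> matrices n; x \<in> X\<rbrakk> \<Longrightarrow> A x \<in> carrier_mat n n"
  by (simp add: matrices_def)

lemma matrices_entry: "\<lbrakk>A \<in> matrices n; i < n; j < n\<rbrakk> \<Longrightarrow> (\<lambda>x. A x $$ (i, j)) \<in> S"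
  by (simp add: matrices_def)

lemma matricesI:
  assumes "\<And>x. x \<in> X \<Longrightarrow> A x \<in> carrier_mat n n"
    and "\<And>i j. \<lbrakk>i < n; j < n\<rbrakk> \<Longrightarrow> a i j \<in> S"
    and "\<And>i j x. \<lbrakk>i < n; j < n; x \<in> X\<rbrakk> \<Longrightarrow> a i j x = A x $$ (i, j)"
  shows "A \<in> matrices n"
proof -
  have "(\<lambda>x. A x $$ (i, j)) \<in> S" if "i < n" "j < n" for i j
    by (rule cong[OF assms(2,3)]) (use that in simp_all)
  then show ?thesis
    using assms(1) by (simp add: matrices_def)
qed

lemma matrices_const: "M \<in> carrier_mat n n \<Longrightarrow> (\<lambda>_. M) \<in> matrices n"
  by (simp add: matrices_def const)

lemma matrices_cong: "\<lbrakk>A \<in> matrices n; \<And>x. x \<in> X \<Longrightarrow> A x = B x\<rbrakk> \<Longrightarrow> B \<in> matrices n"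
  by (rule matricesI[where a = "\<lambda>i j x. A x $$ (i, j)"])
     (auto intro: matrices_entry dest: matrices_carrier)

lemma matrices_add:
  assumes "A \<in> matrices n" "B \<in> matrices n"
  shows "(\<lambda>x. A x + B x) \<in> matrices n"
  by (rule matricesI[where a = "\<lambda>i j x. A x $$ (i, j) + B x $$ (i, j)"])
     (use assms in \<open>auto intro!: add matrices_entry dest: matrices_carrier\<close>)

lemma matrices_smult:
  assumes "A \<in> matrices n"
  shows "(\<lambda>x. c \<cdot>\<^sub>m A x) \<in> matrices n"
  by (rule matricesI[where a = "\<lambda>i j x. c * A x $$ (i, j)"])
     (use assms in \<open>auto intro!: mult const matrices_entry dest: matrices_carrier\<close>)

lemma matrices_mult:
  assumes "A \<in> matrices n" "B \<in> matrices n"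
  shows "(\<lambda>x. A x * B x) \<in> matrices n"
proof (rule matricesI[where a = "\<lambda>i j x. \<Sum>k\<in>{0..<n}. A x $$ (i, k) * B x $$ (k, j)"])
  show "(\<Sum>k\<in>{0..<n}. A x $$ (i, k) * B x $$ (k, j)) = (A x * B x) $$ (i, j)"
    if "i < n" "j < n" "x \<in> X" for i j x
    using assms[THEN matrices_carrier, OF that(3)] that by (simp add: scalar_prod_def)
qed (use assms in \<open>auto intro!: sum mult matrices_entry mult_carrier_mat dest: matrices_carrier\<close>)

lemma det_mem:
  assumes "A \<in> matrices n"
  shows "(\<lambda>x. Determinant.det (A x)) \<in> S"
proof (rule cong)
  show "(\<lambda>x. \<Sum>p\<in>{p. p permutes {0..<n}}. signof p * (\<Prod>i\<in>{0..<n}. A x $$ (i, p i))) \<in> S"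
    using assms by (intro sum mult const prod matrices_entry) (auto dest: permutes_in_image)
  show "(\<Sum>p\<in>{p. p permutes {0..<n}}. signof p * (\<Prod>i\<in>{0..<n}. A x $$ (i, p i))) =
      Determinant.det (A x)" if "x \<in> X" for x
    using matrices_carrier[OF assms that] by (simp add: Determinant.det_def)
qed

lemma matrices_mat_delete:
  assumes "A \<in> matrices n"
  shows "(\<lambda>x. mat_delete (A x) i j) \<in> matrices (n - 1)"
proof (rule matricesI[where
      a = "\<lambda>k l x. A x $$ (if k < i then k else Suc k, if l < j then l else Suc l)"])
  show "mat_delete (A x) i j \<in> carrier_mat (n - 1) (n - 1)" if "x \<in> X" for x
    using matrices_carrier[OF assms that] by (rule mat_delete_carrier)
  show "(\<lambda>x. A x $$ (if k < i then k else Suc k, if l < j then l else Suc l)) \<in> S"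
    if "k < n - 1" "l < n - 1" for k l
    using that by (intro matrices_entry[OF assms]) auto
  show "A x $$ (if k < i then k else Suc k, if l < j then l else Suc l) = mat_delete (A x) i j $$ (k, l)"
    if "k < n - 1" "l < n - 1" "x \<in> X" for k l x
    using matrices_carrier[OF assms that(3)] that by (simp add: mat_delete_def)
qed

lemma matrices_adj_mat:
  assumes "A \<in> matrices n"
  shows "(\<lambda>x. adj_mat (A x)) \<in> matrices n"
proof (rule matricesI[where a = "\<lambda>i j x. (- 1) ^ (j + i) * Determinant.det (mat_delete (A x) j i)"])
  show "(\<lambda>x. (- 1) ^ (j + i) * Determinant.det (mat_delete (A x) j i)) \<in> S" for i j
    by (intro mult const det_mem[where n = "n - 1"] matrices_mat_delete assms)
  show "(- 1) ^ (j + i) * Determinant.det (mat_delete (A x) j i) = adj_mat (A x) $$ (i, j)"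
    if "i < n" "j < n" "x \<in> X" for i j x
    using matrices_carrier[OF assms that(3)] that by (simp add: adj_mat_def cofactor_def)
qed (use assms in \<open>auto intro!: adj_mat dest: matrices_carrier\<close>)

end

interpretation smooth: function_algebra circle "{g. smooth_on_circle g}"
  by unfold_locales (auto intro: smooth_on_circle_const smooth_on_circle_add smooth_on_circle_mult
      smooth_on_circle_cong)

interpretation disc: function_algebra "cball 0 1 :: complex set"
  "{g. continuous_on (cball 0 1) g \<and> g holomorphic_on ball 0 1}"
proof
  fix f g :: "complex \<Rightarrow> complex"
  assume f: "f \<in> {g. continuous_on (cball 0 1) g \<and> g holomorphic_on ball 0 1}"
    and eq: "\<And>x. x \<in> cball 0 1 \<Longrightarrow> f x = g x"
  have "continuous_on (cball 0 1) g"
    using f eq continuous_on_cong[OF refl, of "cball 0 1" f g] by simp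
  moreover have "g holomorphic_on ball 0 1"
    using f eq by (auto intro: holomorphic_transform)
  ultimately show "g \<in> {g. continuous_on (cball 0 1) g \<and> g holomorphic_on ball 0 1}"
    by simp
qed (auto intro!: continuous_intros holomorphic_intros)

lemma smooth_loops_eq: "smooth_loops n = {f \<in> smooth.matrices n. f \<in> extensional circle}"
  unfolding smooth_loops_def smooth.matrices_def by (auto simp: PiE_def Pi_def)

lemma disc_holomorphic_eq: "disc_holomorphic n F \<longleftrightarrow> F \<in> disc.matrices n"
  unfolding disc_holomorphic_def disc.matrices_def by auto

lemma smooth_loops_restrict: "F \<in> smooth.matrices n \<Longrightarrow> restrict F circle \<in> smooth_loops n"
  unfolding smooth_loops_eq by (auto intro: smooth.matrices_cong)


section \<open>The loop groups\<close>

lemma loop_SL_simps: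
  "carrier (loop_SL n) = {f \<in> smooth_loops n. \<forall>z\<in>circle. Determinant.det (f z) = 1}"
  "mult (loop_SL n) f g = (\<lambda>z\<in>circle. f z * g z)"
  "one (loop_SL n) = (\<lambda>z\<in>circle. 1\<^sub>m n)"
  by (simp_all add: loop_SL_def)

text \<open>At determinant 1 the inverse is the adjugate, hence polynomial in the entries. Inversion
  of loops thereby preserves smoothness and holomorphic extendability.\<close>

lemma adj_mat_det_1:
  assumes "A \<in> carrier_mat n n" "Determinant.det A = (1 :: complex)"
  shows "A * adj_mat A = 1\<^sub>m n" "adj_mat A * A = 1\<^sub>m n" "adj_mat A \<in> carrier_mat n n"
    "Determinant.det (adj_mat A) = 1"
proof -
  have "(1 :: complex) \<cdot>\<^sub>m 1\<^sub>m n = 1\<^sub>m n"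
    by (intro eq_matI) auto
  then show eq: "A * adj_mat A = 1\<^sub>m n" "adj_mat A * A = 1\<^sub>m n" "adj_mat A \<in> carrier_mat n n"
    using adj_mat[OF assms(1)] by (simp_all add: assms(2))
  show "Determinant.det (adj_mat A) = 1"
    using Determinant.det_mult[OF assms(1) eq(3)] eq(1) assms(2) by simp
qed

lemma loop_SL_carrierI:
  assumes "F \<in> smooth.matrices n" "\<And>z. z \<in> circle \<Longrightarrow> Determinant.det (F z) = 1"
  shows "restrict F circle \<in> carrier (loop_SL n)"
  using assms by (simp add: loop_SL_simps smooth_loops_restrict)

lemma loop_SL_carrierD:
  assumes "f \<in> carrier (loop_SL n)"
  shows "f \<in> smooth.matrices n" "f \<in> extensional circle"
    "z \<in> circle \<Longrightarrow> f z \<in> carrier_mat n n" "z \<in> circle \<Longrightarrow> Determinant.det (f z) = 1"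
  using assms by (auto simp: loop_SL_simps smooth_loops_eq dest: smooth.matrices_carrier)

lemma loop_SL_adj_mat_closed:
  assumes "f \<in> carrier (loop_SL n)"
  shows "(\<lambda>z\<in>circle. adj_mat (f z)) \<in> carrier (loop_SL n)"
  using assms by (intro loop_SL_carrierI smooth.matrices_adj_mat)
    (simp_all add: adj_mat_det_1(4)[OF loop_SL_carrierD(3,4)[OF assms]] loop_SL_carrierD(1)[OF assms])

lemma group_loop_SL: "group (loop_SL n)"
proof (rule groupI)
  fix f g assume "f \<in> carrier (loop_SL n)" "g \<in> carrier (loop_SL n)"
  note fg = this[THEN loop_SL_carrierD(1)] this[THEN loop_SL_carrierD(3)] this[THEN loop_SL_carrierD(4)]
  show "f \<otimes>\<^bsub>loop_SL n\<^esub> g \<in> carrier (loop_SL n)"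
    unfolding loop_SL_simps(2)
    by (intro loop_SL_carrierI smooth.matrices_mult fg) (simp add: Determinant.det_mult[of _ n] fg)
next
  show "\<one>\<^bsub>loop_SL n\<^esub> \<in> carrier (loop_SL n)"
    unfolding loop_SL_simps(3) by (intro loop_SL_carrierI smooth.matrices_const) simp_all
next
  fix f g h
  assume "f \<in> carrier (loop_SL n)" "g \<in> carrier (loop_SL n)" "h \<in> carrier (loop_SL n)"
  note c = this[THEN loop_SL_carrierD(3)]
  show "f \<otimes>\<^bsub>loop_SL n\<^esub> g \<otimes>\<^bsub>loop_SL n\<^esub> h = f \<otimes>\<^bsub>loop_SL n\<^esub> (g \<otimes>\<^bsub>loop_SL n\<^esub> h)"
    unfolding loop_SL_simps by (rule restrict_ext) (simp add: assoc_mult_mat[OF c])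
next
  fix f assume f: "f \<in> carrier (loop_SL n)"
  show "\<one>\<^bsub>loop_SL n\<^esub> \<otimes>\<^bsub>loop_SL n\<^esub> f = f"
    unfolding loop_SL_simps using loop_SL_carrierD(2)[OF f]
    by (intro extensionalityI[of _ circle]) (auto simp: left_mult_one_mat[OF loop_SL_carrierD(3)[OF f]])
  have "(\<lambda>z\<in>circle. adj_mat (f z)) \<otimes>\<^bsub>loop_SL n\<^esub> f = \<one>\<^bsub>loop_SL n\<^esub>"
    unfolding loop_SL_simps
    by (rule restrict_ext) (simp add: adj_mat_det_1[OF loop_SL_carrierD(3,4)[OF f]])
  then show "\<exists>g\<in>carrier (loop_SL n). g \<otimes>\<^bsub>loop_SL n\<^esub> f = \<one>\<^bsub>loop_SL n\<^esub>"
    using loop_SL_adj_mat_closed[OF f] by blast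
qed

interpretation loop_SL: group "loop_SL n" for n
  by (rule group_loop_SL)

lemma loop_SL_inv:
  assumes f: "f \<in> carrier (loop_SL n)"
  shows "inv\<^bsub>loop_SL n\<^esub> f = (\<lambda>z\<in>circle. adj_mat (f z))"
proof (rule loop_SL.inv_equality)
  show "(\<lambda>z\<in>circle. adj_mat (f z)) \<otimes>\<^bsub>loop_SL n\<^esub> f = \<one>\<^bsub>loop_SL n\<^esub>"
    unfolding loop_SL_simps
    by (rule restrict_ext) (simp add: adj_mat_det_1[OF loop_SL_carrierD(3,4)[OF f]])
qed (use f loop_SL_adj_mat_closed in auto)

lemma subgroup_loop_SL_plus: "subgroup (loop_SL_plus n) (loop_SL n)"
proof (rule loop_SL.subgroupI)
  show "loop_SL_plus n \<subseteq> carrier (loop_SL n)"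
    by (auto simp: loop_SL_plus_def)
  have "\<one>\<^bsub>loop_SL n\<^esub> \<in> loop_SL_plus n"
    unfolding loop_SL_plus_def disc_holomorphic_eq
    by (auto simp: loop_SL_simps(3) intro!: disc.matrices_const exI[of _ "\<lambda>_. 1\<^sub>m n"]
        loop_SL.one_closed[unfolded loop_SL_simps(3)])
  then show "loop_SL_plus n \<noteq> {}"
    by blast
next
  fix f assume "f \<in> loop_SL_plus n"
  then obtain F where f: "f \<in> carrier (loop_SL n)" and F: "F \<in> disc.matrices n"
    "\<And>z. z \<in> circle \<Longrightarrow> f z = F z"
    unfolding loop_SL_plus_def disc_holomorphic_eq by auto
  have "inv\<^bsub>loop_SL n\<^esub> f \<in> carrier (loop_SL n)"
    using f by simp
  \<comment> \<open>The extension of the inverse is the adjugate of F. Only on the circle does it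
    have to be an inverse, so the determinant of F inside the disc does not enter.\<close>
  then show "inv\<^bsub>loop_SL n\<^esub> f \<in> loop_SL_plus n"
    using F disc.matrices_adj_mat[OF F(1)]
    by (auto simp: loop_SL_plus_def disc_holomorphic_eq loop_SL_inv[OF f])
next
  fix f g assume fg: "f \<in> loop_SL_plus n" "g \<in> loop_SL_plus n"
  then obtain F G where F: "F \<in> disc.matrices n" "\<And>z. z \<in> circle \<Longrightarrow> f z = F z"
    and G: "G \<in> disc.matrices n" "\<And>z. z \<in> circle \<Longrightarrow> g z = G z"
    unfolding loop_SL_plus_def disc_holomorphic_eq by auto
  have "f \<otimes>\<^bsub>loop_SL n\<^esub> g \<in> carrier (loop_SL n)"
    using fg by (simp add: loop_SL_plus_def)
  then show "f \<otimes>\<^bsub>loop_SL n\<^esub> g \<in> loop_SL_plus n"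
    using F G disc.matrices_mult[OF F(1) G(1)]
    by (auto simp: loop_SL_plus_def disc_holomorphic_eq loop_SL_simps(2))
qed

lemma subgroup_loop_SL_minus: "subgroup (loop_SL_minus n) (loop_SL n)"
proof (rule loop_SL.subgroupI)
  show "loop_SL_minus n \<subseteq> carrier (loop_SL n)"
    by (auto simp: loop_SL_minus_def)
  have "\<one>\<^bsub>loop_SL n\<^esub> \<in> loop_SL_minus n"
    unfolding loop_SL_minus_def disc_holomorphic_eq
    by (auto simp: loop_SL_simps(3) intro!: disc.matrices_const exI[of _ "\<lambda>_. 1\<^sub>m n"]
        loop_SL.one_closed[unfolded loop_SL_simps(3)])
  then show "loop_SL_minus n \<noteq> {}"
    by blast
next
  fix f assume "f \<in> loop_SL_minus n"
  then obtain F where f: "f \<in> carrier (loop_SL n)" and F: "F \<in> disc.matrices n" "F 0 = 1\<^sub>m n"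
    "\<And>z. z \<in> circle \<Longrightarrow> f z = F (1 / z)"
    unfolding loop_SL_minus_def disc_holomorphic_eq by auto
  have "inv\<^bsub>loop_SL n\<^esub> f \<in> carrier (loop_SL n)"
    using f by simp
  moreover have "adj_mat (1\<^sub>m n :: complex mat) = 1\<^sub>m n"
    using adj_mat_det_1(1,3)[of "1\<^sub>m n" n] by (simp add: Determinant.det_one)
  ultimately show "inv\<^bsub>loop_SL n\<^esub> f \<in> loop_SL_minus n"
    using F disc.matrices_adj_mat[OF F(1)]
    by (auto simp: loop_SL_minus_def disc_holomorphic_eq loop_SL_inv[OF f]
        intro!: exI[of _ "\<lambda>z. adj_mat (F z)"])
next
  fix f g assume fg: "f \<in> loop_SL_minus n" "g \<in> loop_SL_minus n"
  then obtain F G where F: "F \<in> disc.matrices n" "F 0 = 1\<^sub>m n" "\<And>z. z \<in> circle \<Longrightarrow> f z = F (1 / z)"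
    and G: "G \<in> disc.matrices n" "G 0 = 1\<^sub>m n" "\<And>z. z \<in> circle \<Longrightarrow> g z = G (1 / z)"
    unfolding loop_SL_minus_def disc_holomorphic_eq by auto
  have "f \<otimes>\<^bsub>loop_SL n\<^esub> g \<in> carrier (loop_SL n)"
    using fg by (simp add: loop_SL_minus_def)
  then show "f \<otimes>\<^bsub>loop_SL n\<^esub> g \<in> loop_SL_minus n"
    using F G disc.matrices_mult[OF F(1) G(1)]
    by (auto simp: loop_SL_minus_def disc_holomorphic_eq loop_SL_simps(2)
        intro!: exI[of _ "\<lambda>z. F z * G z"])
qed

text \<open>A Liouville argument in terms of Fourier coefficients.\<close>

lemma loop_SL_plus_Int_minus: "loop_SL_plus n \<inter> loop_SL_minus n = {\<one>\<^bsub>loop_SL n\<^esub>}"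
proof (intro equalityI subsetI)
  fix f assume "f \<in> loop_SL_plus n \<inter> loop_SL_minus n"
  then have f: "f \<in> carrier (loop_SL n)" and fp: "f \<in> loop_SL_plus n" and fm: "f \<in> loop_SL_minus n"
    by (auto simp: loop_SL_plus_def)
  from fp obtain F where F: "F \<in> disc.matrices n" "\<forall>z\<in>circle. f z = F z"
    unfolding loop_SL_plus_def disc_holomorphic_eq by blast
  from fm obtain G where G: "G \<in> disc.matrices n" "G 0 = 1\<^sub>m n" "\<forall>z\<in>circle. f z = G (1 / z)"
    unfolding loop_SL_minus_def disc_holomorphic_eq by blast
  have "f z $$ (i, j) = 1\<^sub>m n $$ (i, j)" if z: "z \<in> circle" and ij: "i < n" "j < n" for z i j
  proof -
    define u where "u z = f z $$ (i, j)" for z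
    have "smooth_on_circle u"
      using smooth.matrices_entry[OF loop_SL_carrierD(1)[OF f] ij] by (simp add: u_def[abs_def])
    then have cont: "continuous_on circle u"
      by (rule smooth_on_circle_imp_continuous_on)
    have hF: "continuous_on (cball 0 1) (\<lambda>z. F z $$ (i, j))" "(\<lambda>z. F z $$ (i, j)) holomorphic_on ball 0 1"
      using disc.matrices_entry[OF F(1) ij] by auto
    have hG: "continuous_on (cball 0 1) (\<lambda>z. G z $$ (i, j))" "(\<lambda>z. G z $$ (i, j)) holomorphic_on ball 0 1"
      using disc.matrices_entry[OF G(1) ij] by auto
    have contG: "continuous_on circle (\<lambda>z. G z $$ (i, j))"
      using hG(1) by (rule continuous_on_subset) auto
    have fourier_neg: "fourier_coeff u (- int k) = 0" if "k > 0" for k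
    proof -
      have "fourier_coeff u (- int k) = fourier_coeff (\<lambda>z. F z $$ (i, j)) (- int k)"
        using F(2) by (intro fourier_coeff_cong) (simp add: u_def)
      then show ?thesis
        using fourier_coeff_holomorphic[OF hF, of k] that by simp
    qed
    \<comment> \<open>On the circle \<open>1 / z\<close> equals \<open>cnj z\<close>, so the
      extension at infinity controls the reflected coefficients. The normalization
      \<open>G 0 = 1\<^sub>m n\<close> fixes the constant term.\<close>
    have pos: "fourier_coeff u (int k) = (if k = 0 then 1\<^sub>m n $$ (i, j) else 0)" for k
    proof -
      have "1 / z = cnj z" if "z \<in> circle" for z
      proof -
        have "z * cnj z = 1"
          using that by (simp flip: complex_norm_square)
        then show ?thesis
          by (simp only: divide_inverse inverse_unique mult_1)
      qed
      then have "fourier_coeff u (int k) = fourier_coeff (\<lambda>z. G (cnj z) $$ (i, j)) (int k)"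
        using G(3) by (intro fourier_coeff_cong) (simp add: u_def)
      also have "\<dots> = fourier_coeff (\<lambda>z. G z $$ (i, j)) (- int k)"
        using fourier_coeff_cnj[OF contG] .
      finally show ?thesis
        using fourier_coeff_holomorphic[OF hG, of k] G(2) by simp
    qed
    have "fourier_coeff (\<lambda>z. u z - 1\<^sub>m n $$ (i, j)) k = 0" for k
    proof (cases k rule: int_cases)
      case (nonneg m)
      then show ?thesis
        by (simp add: fourier_coeff_diff[OF cont continuous_on_const] fourier_coeff_const pos
            del: index_one_mat)
    next
      case (neg m)
      then show ?thesis
        using fourier_neg[of "Suc m"]
        by (simp add: fourier_coeff_diff[OF cont continuous_on_const] fourier_coeff_const
            del: index_one_mat of_nat_Suc)
    qed
    then have "u z - 1\<^sub>m n $$ (i, j) = 0"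
      by (rule fourier_coeff_unique[where f = "\<lambda>z. u z - 1\<^sub>m n $$ (i, j)",
            OF continuous_on_diff[OF cont continuous_on_const] _ z])
    then show ?thesis
      by (simp add: u_def)
  qed
  then have "f z = 1\<^sub>m n" if "z \<in> circle" for z
    using loop_SL_carrierD(3)[OF f that] that by (intro eq_matI) auto
  then show "f \<in> {\<one>\<^bsub>loop_SL n\<^esub>}"
    unfolding loop_SL_simps using loop_SL_carrierD(2)[OF f]
    by (simp, intro extensionalityI[of f circle]) simp_all
next
  fix f assume "f \<in> {\<one>\<^bsub>loop_SL n\<^esub>}"
  then show "f \<in> loop_SL_plus n \<inter> loop_SL_minus n"
    using subgroup.one_closed[OF subgroup_loop_SL_plus] subgroup.one_closed[OF subgroup_loop_SL_minus]
    by simp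
qed


section \<open>The KdV reality condition\<close>

lemma kdv_alpha_cis: "kdv_alpha n = cis (2 * pi / n)"
  by (simp add: kdv_alpha_def cis_conv_exp mult_ac)

lemma kdv_alpha_circle: "kdv_alpha n \<in> circle"
  by (simp add: kdv_alpha_cis)

lemma kdv_alpha_mult_circle: "z \<in> circle \<Longrightarrow> kdv_alpha n * z \<in> circle"
  using kdv_alpha_circle[of n] by (simp add: norm_mult)

lemma kdv_alpha_power_n: "n > 0 \<Longrightarrow> kdv_alpha n ^ n = 1"
  by (simp add: kdv_alpha_cis Complex.DeMoivre)

lemma kdv_alpha_power_neq_1:
  assumes "0 < k" "k < n"
  shows "kdv_alpha n ^ k \<noteq> 1"
proof
  assume "kdv_alpha n ^ k = 1"
  then have "cis (2 * pi * (k / n)) = 1"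
    by (simp add: kdv_alpha_cis Complex.DeMoivre mult_ac)
  then have "cos (2 * pi * (k / n)) = 1"
    by (metis cis.sel(1) one_complex.sel(1))
  then obtain m :: int where "2 * pi * (k / n) = of_int m * 2 * pi"
    by (auto simp: cos_one_2pi_int)
  then have "real k = of_int m * real n"
    using assms by (simp add: field_simps)
  then have "int k = m * int n"
    by (metis of_int_eq_iff of_int_mult of_int_of_nat_eq)
  then have "int n dvd int k"
    by simp
  then show False
    using assms by (simp add: nat_dvd_not_less)
qed

lemma one_minus_kdv_alpha_mult_sigma:
  assumes "n \<ge> 2"
  shows "(1 - kdv_alpha n) * kdv_sigma n k = 1 - kdv_alpha n ^ k"
  using kdv_alpha_power_neq_1[of 1 n] assms by (simp add: kdv_sigma_def)

text \<open>This makes the q-factorials invertible below n. At k = n the q-integer is 0, so \<phi>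
  extends exactly as far as its coefficients make sense.\<close>

lemma kdv_sigma_nonzero: "\<lbrakk>0 < k; k < n\<rbrakk> \<Longrightarrow> kdv_sigma n k \<noteq> 0"
  using kdv_alpha_power_neq_1[of k n] kdv_alpha_power_neq_1[of 1 n]
  by (cases "k = 1") (auto simp: kdv_sigma_def)

section \<open>The entries of \<phi> and its q-difference equation\<close>

lemma kdv_Lambda_power_carrier: "kdv_Lambda n ^\<^sub>m k \<in> carrier_mat n n"
  by (rule pow_carrier_mat) (simp add: kdv_Lambda_def)

text \<open>\<Lambda> moves the basis vector j to j + 1 with weight
  \<open>kdv_sigma n (j + 1)\<close>, so a power collects the weights along the path from j to i.
  The induction splits off the rightmost factor, which changes j and keeps i.\<close>

lemma kdv_Lambda_power_index:
  assumes "i < n" "j < n"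
  shows "(kdv_Lambda n ^\<^sub>m k) $$ (i, j) = (if i = j + k then \<Prod>l\<in>{j<..i}. kdv_sigma n l else 0)"
  using assms
proof (induction k arbitrary: j)
  case (Suc k)
  have "(kdv_Lambda n ^\<^sub>m Suc k) $$ (i, j) =
      (\<Sum>m\<in>{0..<n}. (kdv_Lambda n ^\<^sub>m k) $$ (i, m) * kdv_Lambda n $$ (m, j))"
    using Suc.prems kdv_Lambda_power_carrier[of n k] by (simp add: kdv_Lambda_def scalar_prod_def)
  also have "\<dots> = (\<Sum>m\<in>{0..<n}. if m = Suc j then (kdv_Lambda n ^\<^sub>m k) $$ (i, m) * kdv_sigma n m else 0)"
    using Suc.prems by (intro sum.cong) (auto simp: kdv_Lambda_def)
  also have "\<dots> = (if Suc j < n then (kdv_Lambda n ^\<^sub>m k) $$ (i, Suc j) * kdv_sigma n (Suc j) else 0)"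
    by simp
  also have "\<dots> = (if i = j + Suc k then \<Prod>l\<in>{j<..i}. kdv_sigma n l else 0)"
  proof (cases "i = j + Suc k")
    case True
    then have "{j<..i} = insert (Suc j) {Suc j<..i}"
      by auto
    then show ?thesis
      using True Suc.prems Suc.IH[of "Suc j"] by (simp add: mult.commute)
  next
    case False
    then show ?thesis
      using Suc.prems Suc.IH[of "Suc j"] by auto
  qed
  finally show ?case .
qed (auto simp: kdv_Lambda_def)

lemma kdv_phi_carrier: "kdv_phi n z \<in> carrier_mat n n"
  by (simp add: kdv_phi_def)

text \<open>Only k = i - j contributes. The product of \<open>kdv_c\<close> and the q-integers is
  the q-binomial coefficient of i over j at q = \<alpha>, so \<phi> is a q-Pascal matrix.\<close>

lemma kdv_phi_index:
  assumes "i < n" "j < n"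
  shows "kdv_phi n z $$ (i, j) =
    (if j \<le> i then kdv_c n (i - j) * (\<Prod>l\<in>{j<..i}. kdv_sigma n l) * z ^ (i - j) else 0)"
proof -
  have "kdv_phi n z $$ (i, j) = (\<Sum>k<n. kdv_c n k * (kdv_Lambda n ^\<^sub>m k) $$ (i, j) * z ^ k)"
    using assms by (simp add: kdv_phi_def)
  also have "\<dots> = (\<Sum>k<n. if k = i - j then
      (if j \<le> i then kdv_c n k * (\<Prod>l\<in>{j<..i}. kdv_sigma n l) * z ^ k else 0) else 0)"
    by (rule sum.cong) (use assms in \<open>auto simp: kdv_Lambda_power_index\<close>)
  finally show ?thesis
    using less_imp_diff_less[OF assms(1), of j] by simp
qed

text \<open>Since the numbers \<open>kdv_c n k\<close> are the coefficients of the q-exponential at \<open>q = kdv_alpha n\<close>,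
  \<open>kdv_phi n\<close> satisfies a first-order q-difference equation with linear factor \<open>kdv_factor n\<close>.\<close>

definition kdv_factor :: "nat \<Rightarrow> complex \<Rightarrow> complex mat" where
  "kdv_factor n z = mat n n (\<lambda>(i, j).
     if i = j then 1 else if i = Suc j then - ((1 - kdv_alpha n ^ i) * z) else 0)"

lemma kdv_factor_carrier: "kdv_factor n z \<in> carrier_mat n n"
  by (simp add: kdv_factor_def)

text \<open>In the last column \<open>Suc j\<close> equals n and the factor
  \<open>1 - kdv_alpha n ^ n\<close> is 0. Taking the index modulo n keeps it in range, and one
  formula serves all columns.\<close>

lemma mult_kdv_factor_index:
  assumes "M \<in> carrier_mat n n" "i < n" "j < n"
  shows "(M * kdv_factor n z) $$ (i, j) =
    M $$ (i, j) - (1 - kdv_alpha n ^ Suc j) * z * M $$ (i, Suc j mod n)"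
proof -
  have "(M * kdv_factor n z) $$ (i, j) = (\<Sum>k\<in>{0..<n}. M $$ (i, k) * kdv_factor n z $$ (k, j))"
    using assms kdv_factor_carrier[of n z] by (simp add: scalar_prod_def)
  also have "\<dots> = (\<Sum>k\<in>{0..<n}. (if k = j then M $$ (i, k) else 0) -
      (if k = Suc j then (1 - kdv_alpha n ^ Suc j) * z * M $$ (i, k) else 0))"
    using assms by (intro sum.cong) (auto simp: kdv_factor_def)
  also have "\<dots> = M $$ (i, j) - (if Suc j < n then (1 - kdv_alpha n ^ Suc j) * z * M $$ (i, Suc j) else 0)"
    using assms by (simp add: sum_subtractf)
  also have "\<dots> = M $$ (i, j) - (1 - kdv_alpha n ^ Suc j) * z * M $$ (i, Suc j mod n)"
  proof (cases "Suc j < n")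
    case False
    then have "Suc j = n"
      using assms by simp
    then show ?thesis
      using kdv_alpha_power_n[of n] by simp
  qed simp
  finally show ?thesis .
qed

text \<open>Row 0 needs no exception: \<open>i - 1\<close> is then 0 by truncated subtraction, and
  its factor \<open>1 - kdv_alpha n ^ 0\<close> is 0.\<close>

lemma kdv_factor_mult_index:
  assumes "M \<in> carrier_mat n n" "i < n" "j < n"
  shows "(kdv_factor n z * M) $$ (i, j) =
    M $$ (i, j) - (1 - kdv_alpha n ^ i) * z * M $$ (i - 1, j)"
proof -
  have "(kdv_factor n z * M) $$ (i, j) = (\<Sum>k\<in>{0..<n}. kdv_factor n z $$ (i, k) * M $$ (k, j))"
    using assms kdv_factor_carrier[of n z] by (simp add: scalar_prod_def)
  also have "\<dots> = (\<Sum>k\<in>{0..<n}. (if k = i then M $$ (k, j) else 0) -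
      (if k = i - 1 then (1 - kdv_alpha n ^ i) * z * M $$ (k, j) else 0))"
    using assms by (cases i) (auto simp: kdv_factor_def intro!: sum.cong)
  also have "\<dots> = M $$ (i, j) - (1 - kdv_alpha n ^ i) * z * M $$ (i - 1, j)"
    using assms by (simp add: sum_subtractf)
  finally show ?thesis .
qed

text \<open>Entrywise this is the identity [i - j] * binom(i, j) = [j + 1] * binom(i, j + 1) for
  q-integers and q-binomials, both sides multiplied by 1 - \<alpha>. On and above the diagonal, the
  subtracted term vanishes because \<phi> is triangular or, in the last column, because of its zero
  factor.\<close>

lemma kdv_phi_alpha_mult:
  assumes n: "n \<ge> 2"
  shows "kdv_phi n (kdv_alpha n * z) = kdv_phi n z * kdv_factor n z"
proof (rule eq_matI)
  fix i j assume "i < dim_row (kdv_phi n z * kdv_factor n z)" "j < dim_col (kdv_phi n z * kdv_factor n z)"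
  then have ij: "i < n" "j < n"
    using kdv_phi_carrier[of n z] kdv_factor_carrier[of n z] by auto
  have "kdv_phi n (kdv_alpha n * z) $$ (i, j) = kdv_phi n z $$ (i, j) -
      (1 - kdv_alpha n ^ Suc j) * z * kdv_phi n z $$ (i, Suc j mod n)"
  proof (cases "Suc j \<le> i")
    case True
    define m where "m = i - Suc j"
    define P where "P = (\<Prod>l\<in>{Suc j<..i}. kdv_sigma n l)"
    have m: "i - j = Suc m" "Suc j < n" "Suc m < n"
      using True ij by (auto simp: m_def)
    have "{j<..i} = insert (Suc j) {Suc j<..i}"
      using True by auto
    then have P: "(\<Prod>l\<in>{j<..i}. kdv_sigma n l) = kdv_sigma n (Suc j) * P"
      by (simp add: P_def)
    \<comment> \<open>The recursion of the inverse q-factorials; cancelling the q-integer is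
      legitimate because Suc m < n.\<close>
    have "kdv_c n m = kdv_sigma n (Suc m) * kdv_c n (Suc m)"
      using kdv_sigma_nonzero[of "Suc m" n] m(3) by (simp add: kdv_c_def prod.cl_ivl_Suc)
    then have c: "(1 - kdv_alpha n) * kdv_c n m = (1 - kdv_alpha n ^ Suc m) * kdv_c n (Suc m)"
      using one_minus_kdv_alpha_mult_sigma[OF n, of "Suc m"] by (metis mult.assoc)
    have "(1 - kdv_alpha n ^ Suc j) * kdv_c n m = (1 - kdv_alpha n) * kdv_c n m * kdv_sigma n (Suc j)"
      using one_minus_kdv_alpha_mult_sigma[OF n, of "Suc j"] by (metis mult.assoc mult.commute)
    also have "\<dots> = (1 - kdv_alpha n ^ Suc m) * kdv_c n (Suc m) * kdv_sigma n (Suc j)"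
      by (simp only: c)
    finally have *: "(1 - kdv_alpha n ^ Suc j) * z * (kdv_c n m * P * z ^ m) =
        (1 - kdv_alpha n ^ Suc m) * kdv_c n (Suc m) * kdv_sigma n (Suc j) * P * z ^ Suc m"
      by (metis (no_types, lifting) mult.assoc mult.commute power_Suc)
    have "kdv_phi n (kdv_alpha n * z) $$ (i, j) =
        kdv_c n (Suc m) * (kdv_sigma n (Suc j) * P) * (kdv_alpha n ^ Suc m * z ^ Suc m)"
      using ij True m by (simp add: kdv_phi_index P power_mult_distrib del: power_Suc)
    moreover have "kdv_phi n z $$ (i, j) = kdv_c n (Suc m) * (kdv_sigma n (Suc j) * P) * z ^ Suc m"
      using ij True m by (simp add: kdv_phi_index P del: power_Suc)
    moreover have "kdv_phi n z $$ (i, Suc j mod n) = kdv_c n m * P * z ^ m"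
      using ij True m by (simp add: kdv_phi_index P_def m_def)
    ultimately show ?thesis
      by (simp only: *) (simp add: algebra_simps del: power_Suc)
  next
    case False
    show ?thesis
    proof (cases "Suc j < n")
      case True
      then show ?thesis
        using False ij by (auto simp: kdv_phi_index)
    next
      case False
      then have "Suc j = n"
        using ij by simp
      then have "kdv_alpha n ^ Suc j = 1"
        using kdv_alpha_power_n[of n] n by simp
      then show ?thesis
        using \<open>\<not> Suc j \<le> i\<close> ij by (simp add: kdv_phi_index del: power_Suc)
    qed
  qed
  then show "kdv_phi n (kdv_alpha n * z) $$ (i, j) = (kdv_phi n z * kdv_factor n z) $$ (i, j)"
    by (simp only: mult_kdv_factor_index[OF kdv_phi_carrier ij])
qed (use kdv_phi_carrier[of n z] kdv_phi_carrier[of n "kdv_alpha n * z"] kdv_factor_carrier[of n z] in auto)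

section \<open>Invertibility of \<phi> and the intertwining relation\<close>

lemma kdv_phi_mat_inv:
  "mat_inv n (kdv_phi n z) \<in> carrier_mat n n"
  "mat_inv n (kdv_phi n z) * kdv_phi n z = 1\<^sub>m n"
  "kdv_phi n z * mat_inv n (kdv_phi n z) = 1\<^sub>m n"
proof -
  interpret R: ring "ring_mat TYPE(complex) n ()"
    by (rule ring_mat)
  have "Determinant.det (kdv_phi n z) = prod_list (diag_mat (kdv_phi n z))"
    by (rule det_lower_triangular[OF _ kdv_phi_carrier]) (simp add: kdv_phi_index)
  also have "diag_mat (kdv_phi n z) = map (\<lambda>_. 1) [0..<n]"
    using kdv_phi_carrier[of n z]
    by (auto simp: diag_mat_def kdv_phi_index kdv_c_def intro!: map_cong)
  also have "prod_list (map (\<lambda>_. 1 :: complex) [0..<n]) = 1"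
    by (induction n) simp_all
  finally have "Determinant.det (kdv_phi n z) = 1" .
  from adj_mat_det_1[OF kdv_phi_carrier this]
  have "kdv_phi n z \<in> Units (ring_mat TYPE(complex) n ())"
    by (auto simp: Units_def ring_mat_simps kdv_phi_carrier)
  from R.Units_inv_closed[OF this] R.Units_l_inv[OF this] R.Units_r_inv[OF this]
  show "mat_inv n (kdv_phi n z) \<in> carrier_mat n n"
    "mat_inv n (kdv_phi n z) * kdv_phi n z = 1\<^sub>m n"
    "kdv_phi n z * mat_inv n (kdv_phi n z) = 1\<^sub>m n"
    by (simp_all add: mat_inv_def ring_mat_simps)
qed

text \<open>Applied with P = \<phi>(z), Q = \<phi>(\<alpha>z), A = f(z) and B = f(\<alpha>z). The
  map sending X to P' X Q is injective, with inverse sending X to P X Q'; because P' Q = N, it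
  carries the two conjugates to N B and A N.\<close>

lemma conj_eq_iff_intertwine:
  fixes P :: "'a :: comm_ring_1 mat"
  assumes c: "P \<in> carrier_mat n n" "P' \<in> carrier_mat n n" "Q \<in> carrier_mat n n" "Q' \<in> carrier_mat n n"
      "N \<in> carrier_mat n n" "A \<in> carrier_mat n n" "B \<in> carrier_mat n n"
    and P: "P * P' = 1\<^sub>m n" "P' * P = 1\<^sub>m n" and Q: "Q * Q' = 1\<^sub>m n" "Q' * Q = 1\<^sub>m n"
    and N: "Q = P * N"
  shows "Q * B * Q' = P * A * P' \<longleftrightarrow> N * B = A * N"
proof -
  note cl = c mult_carrier_mat[of _ n n _ n]
  have PQ: "P' * Q = N"
    using c P(2) by (simp add: N flip: assoc_mult_mat[of P' n n P n N n])
  have "P' * (Q * B * Q') * Q = P' * Q * B * (Q' * Q)" "P' * (P * A * P') * Q = (P' * P) * A * (P' * Q)"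
    using c by (simp_all add: assoc_mult_mat[where n\<^sub>1 = n and n\<^sub>2 = n and n\<^sub>3 = n and n\<^sub>4 = n] cl)
  then have 1: "P' * (Q * B * Q') * Q = N * B" "P' * (P * A * P') * Q = A * N"
    unfolding PQ P Q by (simp_all add: right_mult_one_mat[of _ n n] left_mult_one_mat[of _ n n] cl)
  have inv: "P * (P' * X * Q) * Q' = X" if X: "X \<in> carrier_mat n n" for X
  proof -
    have "P * (P' * X * Q) * Q' = (P * P') * X * (Q * Q')"
      using c X by (simp add: assoc_mult_mat[where n\<^sub>1 = n and n\<^sub>2 = n and n\<^sub>3 = n and n\<^sub>4 = n] cl)
    then show ?thesis
      using X by (simp add: P Q right_mult_one_mat[of _ n n] left_mult_one_mat[of _ n n])
  qed
  show ?thesis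
    using 1 inv[of "Q * B * Q'"] inv[of "P * A * P'"] cl by metis
qed

lemma kdv_reality_iff:
  assumes "n \<ge> 2" and f: "\<And>z. z \<in> circle \<Longrightarrow> f z \<in> carrier_mat n n"
  shows "kdv_reality n f \<longleftrightarrow>
    (\<forall>z\<in>circle. kdv_factor n z * f (kdv_alpha n * z) = f z * kdv_factor n z)"
  unfolding kdv_reality_def kdv_conj_def
  by (intro ball_cong refl conj_eq_iff_intertwine[where n = n] kdv_phi_carrier kdv_phi_mat_inv
      kdv_factor_carrier f kdv_alpha_mult_circle kdv_phi_alpha_mult assms(1))

lemma kdv_realityD:
  assumes "kdv_reality n f" "n \<ge> 2" "\<And>z. z \<in> circle \<Longrightarrow> f z \<in> carrier_mat n n" "z \<in> circle"
  shows "kdv_factor n z * f (kdv_alpha n * z) = f z * kdv_factor n z"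
  using kdv_reality_iff[of n f] assms by blast

lemma kdv_realityI:
  assumes "n \<ge> 2" "\<And>z. z \<in> circle \<Longrightarrow> f z \<in> carrier_mat n n"
    and "\<And>z. z \<in> circle \<Longrightarrow> kdv_factor n z * f (kdv_alpha n * z) = f z * kdv_factor n z"
  shows "kdv_reality n f"
  using kdv_reality_iff[of n f] assms by blast

lemma kdv_reality_cong:
  assumes "\<And>z. z \<in> circle \<Longrightarrow> f z = g z"
  shows "kdv_reality n f \<longleftrightarrow> kdv_reality n g"
  unfolding kdv_reality_def kdv_conj_def
  using assms kdv_alpha_mult_circle by (intro ball_cong refl) simp

lemma kdv_reality_restrict: "kdv_reality n (restrict f circle) \<longleftrightarrow> kdv_reality n f"
  by (rule kdv_reality_cong) simp

section \<open>Stability of the reality condition under the matrix operations\<close>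

lemma kdv_reality_const_one: "kdv_reality n (\<lambda>_. 1\<^sub>m n)"
  unfolding kdv_reality_def kdv_conj_def
  by (simp add: right_mult_one_mat[OF kdv_phi_carrier] kdv_phi_mat_inv)

lemma kdv_reality_const_zero: "n \<ge> 2 \<Longrightarrow> kdv_reality n (\<lambda>_. 0\<^sub>m n n)"
  by (simp add: kdv_reality_iff right_mult_zero_mat[OF kdv_factor_carrier]
      left_mult_zero_mat[OF kdv_factor_carrier])

lemma kdv_reality_mult:
  assumes n: "n \<ge> 2" and f: "\<And>z. z \<in> circle \<Longrightarrow> f z \<in> carrier_mat n n" "kdv_reality n f"
    and g: "\<And>z. z \<in> circle \<Longrightarrow> g z \<in> carrier_mat n n" "kdv_reality n g"
  shows "kdv_reality n (\<lambda>z. f z * g z)"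
proof -
  have "kdv_factor n z * (f (kdv_alpha n * z) * g (kdv_alpha n * z)) = f z * g z * kdv_factor n z"
    if z: "z \<in> circle" for z
  proof -
    define w where "w = kdv_alpha n * z"
    have w: "w \<in> circle"
      unfolding w_def by (rule kdv_alpha_mult_circle[OF z])
    note c = f(1)[OF z] f(1)[OF w] g(1)[OF z] g(1)[OF w] kdv_factor_carrier[of n z]
    have "kdv_factor n z * (f w * g w) = kdv_factor n z * f w * g w"
      using c by (simp add: assoc_mult_mat[of _ n n _ n _ n])
    also have "kdv_factor n z * f w = f z * kdv_factor n z"
      unfolding w_def by (rule kdv_realityD[OF f(2) n f(1) z])
    also have "f z * kdv_factor n z * g w = f z * (kdv_factor n z * g w)"
      using c by (simp add: assoc_mult_mat[of _ n n _ n _ n])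
    also have "kdv_factor n z * g w = g z * kdv_factor n z"
      unfolding w_def by (rule kdv_realityD[OF g(2) n g(1) z])
    also have "f z * (g z * kdv_factor n z) = f z * g z * kdv_factor n z"
      using c by (simp add: assoc_mult_mat[of _ n n _ n _ n])
    finally show ?thesis
      by (simp add: w_def)
  qed
  then show ?thesis
    by (intro kdv_realityI n mult_carrier_mat[of _ n n] f(1) g(1))
qed

lemma kdv_reality_add:
  assumes n: "n \<ge> 2" and f: "\<And>z. z \<in> circle \<Longrightarrow> f z \<in> carrier_mat n n" "kdv_reality n f"
    and g: "\<And>z. z \<in> circle \<Longrightarrow> g z \<in> carrier_mat n n" "kdv_reality n g"
  shows "kdv_reality n (\<lambda>z. f z + g z)"
proof -
  have "kdv_factor n z * (f (kdv_alpha n * z) + g (kdv_alpha n * z)) = (f z + g z) * kdv_factor n z"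
    if z: "z \<in> circle" for z
  proof -
    note w = kdv_alpha_mult_circle[OF z, of n]
    show ?thesis
      by (simp only: mult_add_distrib_mat[OF kdv_factor_carrier f(1)[OF w] g(1)[OF w]]
          add_mult_distrib_mat[OF f(1)[OF z] g(1)[OF z] kdv_factor_carrier]
          kdv_realityD[OF f(2) n f(1) z] kdv_realityD[OF g(2) n g(1) z])
  qed
  then show ?thesis
    by (intro kdv_realityI n add_carrier_mat g(1))
qed

lemma kdv_reality_smult:
  assumes n: "n \<ge> 2" and f: "\<And>z. z \<in> circle \<Longrightarrow> f z \<in> carrier_mat n n" "kdv_reality n f"
  shows "kdv_reality n (\<lambda>z. a \<cdot>\<^sub>m f z)"
proof -
  have "kdv_factor n z * (a \<cdot>\<^sub>m f (kdv_alpha n * z)) = a \<cdot>\<^sub>m f z * kdv_factor n z"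
    if z: "z \<in> circle" for z
  proof -
    note w = kdv_alpha_mult_circle[OF z, of n]
    show ?thesis
      by (simp only: mult_smult_distrib[OF kdv_factor_carrier f(1)[OF w]]
          mult_smult_assoc_mat[OF f(1)[OF z] kdv_factor_carrier] kdv_realityD[OF f(2) n f(1) z])
  qed
  then show ?thesis
    by (intro kdv_realityI n smult_carrier_mat f(1))
qed

text \<open>Multiplying the intertwining relation by the inverse of f(z) on the left and the inverse
  of f(\<alpha>z) on the right gives the relation for the inverse loop.\<close>

lemma kdv_reality_adj_mat:
  assumes n: "n \<ge> 2" and f: "\<And>z. z \<in> circle \<Longrightarrow> f z \<in> carrier_mat n n" "kdv_reality n f"
    and det: "\<And>z. z \<in> circle \<Longrightarrow> Determinant.det (f z) = 1"
  shows "kdv_reality n (\<lambda>z. adj_mat (f z))"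
proof -
  have "kdv_factor n z * adj_mat (f (kdv_alpha n * z)) = adj_mat (f z) * kdv_factor n z"
    if z: "z \<in> circle" for z
  proof -
    define w where "w = kdv_alpha n * z"
    have w: "w \<in> circle"
      unfolding w_def by (rule kdv_alpha_mult_circle[OF z])
    note adj_z = adj_mat_det_1[OF f(1)[OF z] det[OF z]]
    note adj_w = adj_mat_det_1[OF f(1)[OF w] det[OF w]]
    note c = f(1)[OF z] f(1)[OF w] adj_z(3) adj_w(3) kdv_factor_carrier[of n z]
    have "adj_mat (f z) * kdv_factor n z = adj_mat (f z) * kdv_factor n z * (f w * adj_mat (f w))"
      using c by (simp add: adj_w right_mult_one_mat[of _ n n] mult_carrier_mat[of _ n n])
    also have "\<dots> = adj_mat (f z) * (kdv_factor n z * f w) * adj_mat (f w)"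
      using c by (simp add: assoc_mult_mat[of _ n n _ n _ n] mult_carrier_mat[of _ n n])
    also have "kdv_factor n z * f w = f z * kdv_factor n z"
      unfolding w_def by (rule kdv_realityD[OF f(2) n f(1) z])
    also have "adj_mat (f z) * (f z * kdv_factor n z) * adj_mat (f w) =
        adj_mat (f z) * f z * kdv_factor n z * adj_mat (f w)"
      using c by (simp add: assoc_mult_mat[of _ n n _ n _ n] mult_carrier_mat[of _ n n])
    also have "\<dots> = kdv_factor n z * adj_mat (f w)"
      using c by (simp add: adj_z left_mult_one_mat[of _ n n])
    finally show ?thesis
      by (simp add: w_def)
  qed
  then show ?thesis
    by (intro kdv_realityI n adj_mat_det_1(3) f(1) det)
qed

text \<open>All explicit dependence on z is gathered into a single factor on the right. In this form
  the condition can be projected by \<open>fourier_plus_shift\<close>.\<close>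

lemma kdv_reality_iff_entries:
  assumes n: "n \<ge> 2" and f: "\<And>z. z \<in> circle \<Longrightarrow> f z \<in> carrier_mat n n"
  shows "kdv_reality n f \<longleftrightarrow> (\<forall>i<n. \<forall>j<n. \<forall>z\<in>circle.
    f (kdv_alpha n * z) $$ (i, j) - f z $$ (i, j) =
    z * ((1 - kdv_alpha n ^ i) * f (kdv_alpha n * z) $$ (i - 1, j) -
      (1 - kdv_alpha n ^ Suc j) * f z $$ (i, Suc j mod n)))"
    (is "_ \<longleftrightarrow> ?R")
proof -
  have "kdv_factor n z * f (kdv_alpha n * z) = f z * kdv_factor n z \<longleftrightarrow> (\<forall>i<n. \<forall>j<n.
      f (kdv_alpha n * z) $$ (i, j) - f z $$ (i, j) =
      z * ((1 - kdv_alpha n ^ i) * f (kdv_alpha n * z) $$ (i - 1, j) -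
        (1 - kdv_alpha n ^ Suc j) * f z $$ (i, Suc j mod n)))" (is "?A = ?B \<longleftrightarrow> ?C")
    if z: "z \<in> circle" for z
  proof -
    note c = f[OF kdv_alpha_mult_circle[OF z, of n]] f[OF z]
    have "?A \<in> carrier_mat n n" "?B \<in> carrier_mat n n"
      using c kdv_factor_carrier[of n z] by (auto intro: mult_carrier_mat)
    then have "?A = ?B \<longleftrightarrow> (\<forall>i<n. \<forall>j<n. ?A $$ (i, j) = ?B $$ (i, j))"
      by (metis carrier_matD eq_matI)
    also have "\<dots> \<longleftrightarrow> ?C"
      by (intro all_cong imp_cong refl)
         (simp only: kdv_factor_mult_index[OF c(1)] mult_kdv_factor_index[OF c(2)],
          simp add: algebra_simps del: power_Suc)
    finally show ?thesis .
  qed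
  then have "kdv_reality n f \<longleftrightarrow> (\<forall>z\<in>circle. \<forall>i<n. \<forall>j<n.
      f (kdv_alpha n * z) $$ (i, j) - f z $$ (i, j) =
      z * ((1 - kdv_alpha n ^ i) * f (kdv_alpha n * z) $$ (i - 1, j) -
        (1 - kdv_alpha n ^ Suc j) * f z $$ (i, Suc j mod n)))"
    using kdv_reality_iff[of n f] n f by simp
  then show ?thesis
    by blast
qed

section \<open>The group of loops satisfying the reality condition\<close>

lemma subgroup_KdV:
  assumes n: "n \<ge> 2"
  shows "subgroup (carrier (KdV_group n)) (loop_SL n)"
proof (rule loop_SL.subgroupI)
  show "carrier (KdV_group n) \<subseteq> carrier (loop_SL n)"
    by (auto simp: KdV_group_def)
  have "\<one>\<^bsub>loop_SL n\<^esub> \<in> carrier (KdV_group n)"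
    using loop_SL.one_closed[of n]
    by (simp add: KdV_group_def loop_SL_simps(3) kdv_reality_restrict kdv_reality_const_one)
  then show "carrier (KdV_group n) \<noteq> {}"
    by blast
next
  fix f assume "f \<in> carrier (KdV_group n)"
  then have f: "f \<in> carrier (loop_SL n)" "kdv_reality n f"
    by (simp_all add: KdV_group_def)
  show "inv\<^bsub>loop_SL n\<^esub> f \<in> carrier (KdV_group n)"
    using loop_SL.inv_closed[OF f(1)] kdv_reality_adj_mat[OF n loop_SL_carrierD(3)[OF f(1)] f(2)]
      loop_SL_carrierD(4)[OF f(1)]
    by (simp add: KdV_group_def loop_SL_inv[OF f(1)] kdv_reality_restrict)
next
  fix f g assume "f \<in> carrier (KdV_group n)" "g \<in> carrier (KdV_group n)"
  then have f: "f \<in> carrier (loop_SL n)" "kdv_reality n f"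
    and g: "g \<in> carrier (loop_SL n)" "kdv_reality n g"
    by (simp_all add: KdV_group_def)
  show "f \<otimes>\<^bsub>loop_SL n\<^esub> g \<in> carrier (KdV_group n)"
    using loop_SL.m_closed[OF f(1) g(1)]
      kdv_reality_mult[OF n loop_SL_carrierD(3)[OF f(1)] f(2) loop_SL_carrierD(3)[OF g(1)] g(2)]
    by (simp add: KdV_group_def loop_SL_simps(2) kdv_reality_restrict)
qed

lemma KdV_group_eq: "KdV_group n = (loop_SL n)\<lparr>carrier := carrier (KdV_group n)\<rparr>"
  by (simp add: KdV_group_def)

lemma subgroup_KdV_Int:
  assumes n: "n \<ge> 2" and H: "subgroup H (loop_SL n)"
  shows "subgroup (H \<inter> carrier (KdV_group n)) (KdV_group n)"
proof -
  have "subgroup (H \<inter> carrier (KdV_group n)) (loop_SL n)"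
    by (rule loop_SL.subgroups_Inter_pair[OF H subgroup_KdV[OF n]])
  then have "subgroup (H \<inter> carrier (KdV_group n)) ((loop_SL n)\<lparr>carrier := carrier (KdV_group n)\<rparr>)"
    by (rule loop_SL.subgroup_incl[OF _ subgroup_KdV[OF n]]) simp
  then show ?thesis
    by (simp flip: KdV_group_eq)
qed

lemma group_KdV:
  assumes "n \<ge> 2"
  shows "group (KdV_group n)"
  using subgroup.subgroup_is_group[OF subgroup_KdV[OF assms] group_loop_SL]
  by (simp flip: KdV_group_eq)


section \<open>The loop algebras\<close>

lemma commutator_identities:
  fixes X Y Z :: "complex mat"
  assumes c: "X \<in> carrier_mat n n" "Y \<in> carrier_mat n n" "Z \<in> carrier_mat n n"
  shows "(X + Y) * Z - Z * (X + Y) = (X * Z - Z * X) + (Y * Z - Z * Y)"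
    and "X * (Y + Z) - (Y + Z) * X = (X * Y - Y * X) + (X * Z - Z * X)"
    and "(a \<cdot>\<^sub>m X) * Y - Y * (a \<cdot>\<^sub>m X) = a \<cdot>\<^sub>m (X * Y - Y * X)"
    and "X * (a \<cdot>\<^sub>m Y) - (a \<cdot>\<^sub>m Y) * X = a \<cdot>\<^sub>m (X * Y - Y * X)"
    and "X * X - X * X = 0\<^sub>m n n"
    and "(X * (Y * Z - Z * Y) - (Y * Z - Z * Y) * X) + (Y * (Z * X - X * Z) - (Z * X - X * Z) * Y) +
      (Z * (X * Y - Y * X) - (X * Y - Y * X) * Z) = 0\<^sub>m n n"
proof -
  note dims = c[THEN carrier_matD(1)] c[THEN carrier_matD(2)]
  \<comment> \<open>After full expansion, entries are compared with \<open>index_mult_mat(1)\<close>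
    removed where products remain: entries of matrix products stay opaque, and the surviving
    identities are additive ones between complex numbers.\<close>
  note distrib = mult_add_distrib_mat[of _ n n _ n] add_mult_distrib_mat[of _ n n _ _ n]
    mult_minus_distrib_mat[of _ n n _ n] minus_mult_distrib_mat[of _ n n _ _ n]
    mult_smult_distrib[of _ n n _ n] mult_smult_assoc_mat[of _ n n _ n]
    assoc_mult_mat[of _ n n _ n _ n] mult_carrier_mat[of _ n n _ n]
  show "(X + Y) * Z - Z * (X + Y) = (X * Z - Z * X) + (Y * Z - Z * Y)"
    by (simp add: distrib c, rule eq_matI) (simp_all add: dims del: index_mult_mat(1))
  show "X * (Y + Z) - (Y + Z) * X = (X * Y - Y * X) + (X * Z - Z * X)"
    by (simp add: distrib c, rule eq_matI) (simp_all add: dims del: index_mult_mat(1))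
  show "(a \<cdot>\<^sub>m X) * Y - Y * (a \<cdot>\<^sub>m X) = a \<cdot>\<^sub>m (X * Y - Y * X)"
    by (simp add: distrib c, rule eq_matI)
       (simp_all add: dims right_diff_distrib del: index_mult_mat(1))
  show "X * (a \<cdot>\<^sub>m Y) - (a \<cdot>\<^sub>m Y) * X = a \<cdot>\<^sub>m (X * Y - Y * X)"
    by (simp add: distrib c, rule eq_matI)
       (simp_all add: dims right_diff_distrib del: index_mult_mat(1))
  show "X * X - X * X = 0\<^sub>m n n"
    by (rule eq_matI) (simp_all add: dims)
  show "(X * (Y * Z - Z * Y) - (Y * Z - Z * Y) * X) + (Y * (Z * X - X * Z) - (Z * X - X * Z) * Y) +
      (Z * (X * Y - Y * X) - (X * Y - Y * X) * Z) = 0\<^sub>m n n"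
    by (simp add: distrib c, rule eq_matI) (simp_all add: dims del: index_mult_mat(1))
qed

lemma mat_trace_add: "\<lbrakk>A \<in> carrier_mat n n; B \<in> carrier_mat n n\<rbrakk> \<Longrightarrow> mat_trace (A + B) = mat_trace A + mat_trace B"
  by (simp add: mat_trace_def sum.distrib)

lemma mat_trace_smult: "A \<in> carrier_mat n n \<Longrightarrow> mat_trace (a \<cdot>\<^sub>m A) = a * mat_trace A"
  by (simp add: mat_trace_def sum_distrib_left)

lemma mat_trace_commutator:
  assumes "A \<in> carrier_mat n n" "B \<in> carrier_mat n n"
  shows "mat_trace (A * B - B * A) = 0"
proof -
  have "(\<Sum>i<n. (A * B) $$ (i, i)) = (\<Sum>i<n. \<Sum>k<n. A $$ (i, k) * B $$ (k, i))"
    using assms by (simp add: scalar_prod_def lessThan_atLeast0)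
  also have "\<dots> = (\<Sum>k<n. \<Sum>i<n. A $$ (i, k) * B $$ (k, i))"
    by (rule sum.swap)
  also have "\<dots> = (\<Sum>i<n. (B * A) $$ (i, i))"
    using assms by (simp add: scalar_prod_def lessThan_atLeast0 mult.commute)
  finally show ?thesis
    using assms by (simp add: mat_trace_def sum_subtractf del: index_mult_mat(1))
qed

lemma loop_sl_simps:
  "carrier (loop_sl n) = {A \<in> smooth_loops n. \<forall>z\<in>circle. mat_trace (A z) = 0}"
  "mult (loop_sl n) A B = (\<lambda>z\<in>circle. A z * B z - B z * A z)"
  "zero (loop_sl n) = (\<lambda>z\<in>circle. 0\<^sub>m n n)"
  "add (loop_sl n) A B = (\<lambda>z\<in>circle. A z + B z)"
  "smult (loop_sl n) a A = (\<lambda>z\<in>circle. a \<cdot>\<^sub>m A z)"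
  by (simp_all add: loop_sl_def)

lemma KdV_algebra_simps:
  "carrier (KdV_algebra n) = {A \<in> carrier (loop_sl n). kdv_reality n A}"
  "mult (KdV_algebra n) A B = (\<lambda>z\<in>circle. A z * B z - B z * A z)"
  "zero (KdV_algebra n) = (\<lambda>z\<in>circle. 0\<^sub>m n n)"
  "add (KdV_algebra n) A B = (\<lambda>z\<in>circle. A z + B z)"
  "smult (KdV_algebra n) a A = (\<lambda>z\<in>circle. a \<cdot>\<^sub>m A z)"
  by (simp_all add: KdV_algebra_def loop_sl_simps)

lemma complex_ring_simps:
  "carrier complex_ring = UNIV" "mult complex_ring = (*)" "one complex_ring = 1"
  "zero complex_ring = 0" "add complex_ring = (+)"
  by (simp_all add: complex_ring_def)

lemma cring_complex_ring: "cring complex_ring"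
proof (rule cringI)
  show "abelian_group complex_ring"
    by (rule abelian_groupI) (auto simp: complex_ring_simps intro: exI[of _ "- _"] left_minus)
  show "Group.comm_monoid complex_ring"
    by (rule comm_monoidI) (auto simp: complex_ring_simps)
qed (simp add: complex_ring_simps distrib_right)

section \<open>The Lie algebra of the reality condition\<close>

lemma KdV_algebraI:
  assumes "F \<in> smooth.matrices n" "\<And>z. z \<in> circle \<Longrightarrow> mat_trace (F z) = 0" "kdv_reality n F"
  shows "restrict F circle \<in> carrier (KdV_algebra n)"
  using assms
  by (simp add: KdV_algebra_simps(1) loop_sl_simps(1) smooth_loops_restrict kdv_reality_restrict)

lemma KdV_algebraD:
  assumes "A \<in> carrier (KdV_algebra n)"
  shows "A \<in> smooth.matrices n" "A \<in> extensional circle" "kdv_reality n A"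
    "z \<in> circle \<Longrightarrow> A z \<in> carrier_mat n n" "z \<in> circle \<Longrightarrow> mat_trace (A z) = 0"
  using assms
  by (auto simp: KdV_algebra_simps(1) loop_sl_simps(1) smooth_loops_eq dest: smooth.matrices_carrier)

lemma KdV_algebra_zero_closed: "n \<ge> 2 \<Longrightarrow> \<zero>\<^bsub>KdV_algebra n\<^esub> \<in> carrier (KdV_algebra n)"
  unfolding KdV_algebra_simps(3)
  by (intro KdV_algebraI smooth.matrices_const kdv_reality_const_zero) (simp_all add: mat_trace_def)

lemma KdV_algebra_add_closed:
  assumes "n \<ge> 2" "A \<in> carrier (KdV_algebra n)" "B \<in> carrier (KdV_algebra n)"
  shows "A \<oplus>\<^bsub>KdV_algebra n\<^esub> B \<in> carrier (KdV_algebra n)"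
  unfolding KdV_algebra_simps(4)
  by (intro KdV_algebraI smooth.matrices_add kdv_reality_add assms KdV_algebraD(1,3,4)[OF assms(2)]
      KdV_algebraD(1,3,4)[OF assms(3)])
     (simp add: mat_trace_add[of _ n] KdV_algebraD[OF assms(2)] KdV_algebraD[OF assms(3)])

lemma KdV_algebra_smult_closed:
  assumes "n \<ge> 2" "A \<in> carrier (KdV_algebra n)"
  shows "a \<odot>\<^bsub>KdV_algebra n\<^esub> A \<in> carrier (KdV_algebra n)"
  unfolding KdV_algebra_simps(5)
  by (intro KdV_algebraI smooth.matrices_smult kdv_reality_smult assms KdV_algebraD(1,3,4)[OF assms(2)])
     (simp add: mat_trace_smult[of _ n] KdV_algebraD[OF assms(2)])

text \<open>Writing the commutator with a sum and a scalar multiple lets the bracket inherit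
  smoothness and the reality condition from the closure results for these operations.\<close>

lemma commutator_eq:
  fixes A B :: "complex mat"
  assumes "A \<in> carrier_mat n n" "B \<in> carrier_mat n n"
  shows "A * B + (- 1) \<cdot>\<^sub>m (B * A) = A * B - B * A"
  using assms by (intro eq_matI) auto

lemma KdV_algebra_bracket_closed:
  assumes n: "n \<ge> 2" and A: "A \<in> carrier (KdV_algebra n)" and B: "B \<in> carrier (KdV_algebra n)"
  shows "A \<otimes>\<^bsub>KdV_algebra n\<^esub> B \<in> carrier (KdV_algebra n)"
proof -
  note AD = KdV_algebraD[OF A] and BD = KdV_algebraD[OF B]
  have "restrict (\<lambda>z. A z * B z + (- 1) \<cdot>\<^sub>m (B z * A z)) circle \<in> carrier (KdV_algebra n)"
    by (intro KdV_algebraI smooth.matrices_add smooth.matrices_smult smooth.matrices_mult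
        kdv_reality_add kdv_reality_smult kdv_reality_mult n AD(1,3,4) BD(1,3,4)
        smult_carrier_mat mult_carrier_mat[of _ n n])
       (simp add: commutator_eq[of _ n] mat_trace_commutator[of _ n] AD BD)
  also have "restrict (\<lambda>z. A z * B z + (- 1) \<cdot>\<^sub>m (B z * A z)) circle = A \<otimes>\<^bsub>KdV_algebra n\<^esub> B"
    unfolding KdV_algebra_simps(2) by (rule restrict_ext) (intro commutator_eq[of _ n] AD BD)
  finally show ?thesis .
qed

lemma lie_algebra_KdV:
  assumes n: "n \<ge> 2"
  shows "lie_algebra complex_ring (KdV_algebra n)"
proof -
  note closed = KdV_algebra_zero_closed[OF n] KdV_algebra_add_closed[OF n]
    KdV_algebra_smult_closed[OF n] KdV_algebra_bracket_closed[OF n]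
  have abelian: "abelian_group (KdV_algebra n)"
  proof (rule abelian_groupI)
    fix A assume A: "A \<in> carrier (KdV_algebra n)"
    note AD = KdV_algebraD[OF A]
    have "((- 1) \<odot>\<^bsub>KdV_algebra n\<^esub> A) \<oplus>\<^bsub>KdV_algebra n\<^esub> A = \<zero>\<^bsub>KdV_algebra n\<^esub>"
      unfolding KdV_algebra_simps by (rule restrict_ext) (auto intro!: eq_matI simp: carrier_matD[OF AD(4)])
    then show "\<exists>B\<in>carrier (KdV_algebra n). B \<oplus>\<^bsub>KdV_algebra n\<^esub> A = \<zero>\<^bsub>KdV_algebra n\<^esub>"
      using closed(3)[OF A] by blast
    show "\<zero>\<^bsub>KdV_algebra n\<^esub> \<oplus>\<^bsub>KdV_algebra n\<^esub> A = A"
      unfolding KdV_algebra_simps using AD(2)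
      by (intro extensionalityI[of _ circle]) (auto simp: left_add_zero_mat[OF AD(4)])
  next
    fix A B C
    assume "A \<in> carrier (KdV_algebra n)" "B \<in> carrier (KdV_algebra n)" "C \<in> carrier (KdV_algebra n)"
    note D = this[THEN KdV_algebraD(4)]
    show "A \<oplus>\<^bsub>KdV_algebra n\<^esub> B \<oplus>\<^bsub>KdV_algebra n\<^esub> C = A \<oplus>\<^bsub>KdV_algebra n\<^esub> (B \<oplus>\<^bsub>KdV_algebra n\<^esub> C)"
      unfolding KdV_algebra_simps by (rule restrict_ext) (simp add: assoc_add_mat[OF D])
  next
    fix A B
    assume "A \<in> carrier (KdV_algebra n)" "B \<in> carrier (KdV_algebra n)"
    note D = this[THEN KdV_algebraD(4)]
    show "A \<oplus>\<^bsub>KdV_algebra n\<^esub> B = B \<oplus>\<^bsub>KdV_algebra n\<^esub> A"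
      unfolding KdV_algebra_simps by (rule restrict_ext) (rule comm_add_mat[OF D])
  qed (use closed in auto)
  have "module complex_ring (KdV_algebra n)"
  proof (rule moduleI[OF cring_complex_ring abelian])
    fix a b A B
    assume "A \<in> carrier (KdV_algebra n)" "B \<in> carrier (KdV_algebra n)"
    note D = this[THEN KdV_algebraD(4)]
    show "(a \<oplus>\<^bsub>complex_ring\<^esub> b) \<odot>\<^bsub>KdV_algebra n\<^esub> A =
        a \<odot>\<^bsub>KdV_algebra n\<^esub> A \<oplus>\<^bsub>KdV_algebra n\<^esub> b \<odot>\<^bsub>KdV_algebra n\<^esub> A"
      unfolding KdV_algebra_simps complex_ring_simps
      by (rule restrict_ext) (auto intro!: eq_matI simp: distrib_right carrier_matD[OF D(1)])
    show "a \<odot>\<^bsub>KdV_algebra n\<^esub> (A \<oplus>\<^bsub>KdV_algebra n\<^esub> B) =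
        a \<odot>\<^bsub>KdV_algebra n\<^esub> A \<oplus>\<^bsub>KdV_algebra n\<^esub> a \<odot>\<^bsub>KdV_algebra n\<^esub> B"
      unfolding KdV_algebra_simps
      by (rule restrict_ext) (auto intro!: eq_matI simp: distrib_left carrier_matD[OF D(1)] carrier_matD[OF D(2)])
    show "(a \<otimes>\<^bsub>complex_ring\<^esub> b) \<odot>\<^bsub>KdV_algebra n\<^esub> A = a \<odot>\<^bsub>KdV_algebra n\<^esub> (b \<odot>\<^bsub>KdV_algebra n\<^esub> A)"
      unfolding KdV_algebra_simps complex_ring_simps
      by (rule restrict_ext) (auto intro!: eq_matI simp: carrier_matD[OF D(1)])
  next
    fix A assume A: "A \<in> carrier (KdV_algebra n)"
    note AD = KdV_algebraD[OF A]
    show "\<one>\<^bsub>complex_ring\<^esub> \<odot>\<^bsub>KdV_algebra n\<^esub> A = A"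
      unfolding KdV_algebra_simps complex_ring_simps using AD(2)
      by (intro extensionalityI[of _ circle]) (auto intro!: eq_matI simp: carrier_matD[OF AD(4)])
  qed (use closed in auto)
  then show ?thesis
  proof (rule lie_algebra.intro)
    show "lie_algebra_axioms complex_ring (KdV_algebra n)"
    proof
      fix a A B C
      assume "A \<in> carrier (KdV_algebra n)" "B \<in> carrier (KdV_algebra n)" "C \<in> carrier (KdV_algebra n)"
      note D = this[THEN KdV_algebraD(4)]
      note ids = commutator_identities[OF D]
      show "(A \<oplus>\<^bsub>KdV_algebra n\<^esub> B) \<otimes>\<^bsub>KdV_algebra n\<^esub> C =
          (A \<otimes>\<^bsub>KdV_algebra n\<^esub> C) \<oplus>\<^bsub>KdV_algebra n\<^esub> (B \<otimes>\<^bsub>KdV_algebra n\<^esub> C)"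
        unfolding KdV_algebra_simps by (rule restrict_ext) (simp add: ids)
      show "A \<otimes>\<^bsub>KdV_algebra n\<^esub> (B \<oplus>\<^bsub>KdV_algebra n\<^esub> C) =
          (A \<otimes>\<^bsub>KdV_algebra n\<^esub> B) \<oplus>\<^bsub>KdV_algebra n\<^esub> (A \<otimes>\<^bsub>KdV_algebra n\<^esub> C)"
        unfolding KdV_algebra_simps by (rule restrict_ext) (simp add: ids)
      show "(A \<otimes>\<^bsub>KdV_algebra n\<^esub> (B \<otimes>\<^bsub>KdV_algebra n\<^esub> C)) \<oplus>\<^bsub>KdV_algebra n\<^esub>
          (B \<otimes>\<^bsub>KdV_algebra n\<^esub> (C \<otimes>\<^bsub>KdV_algebra n\<^esub> A)) \<oplus>\<^bsub>KdV_algebra n\<^esub>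
          (C \<otimes>\<^bsub>KdV_algebra n\<^esub> (A \<otimes>\<^bsub>KdV_algebra n\<^esub> B)) = \<zero>\<^bsub>KdV_algebra n\<^esub>"
        unfolding KdV_algebra_simps by (rule restrict_ext) (simp add: ids)
    next
      fix a A B
      assume "A \<in> carrier (KdV_algebra n)" "B \<in> carrier (KdV_algebra n)"
      note D = this[THEN KdV_algebraD(4)]
      note ids = commutator_identities[OF D D(2)]
      show "(a \<odot>\<^bsub>KdV_algebra n\<^esub> A) \<otimes>\<^bsub>KdV_algebra n\<^esub> B = a \<odot>\<^bsub>KdV_algebra n\<^esub> (A \<otimes>\<^bsub>KdV_algebra n\<^esub> B)"
        unfolding KdV_algebra_simps by (rule restrict_ext) (simp add: ids)
      show "A \<otimes>\<^bsub>KdV_algebra n\<^esub> (a \<odot>\<^bsub>KdV_algebra n\<^esub> B) = a \<odot>\<^bsub>KdV_algebra n\<^esub> (A \<otimes>\<^bsub>KdV_algebra n\<^esub> B)"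
        unfolding KdV_algebra_simps by (rule restrict_ext) (simp add: ids)
    next
      fix A assume "A \<in> carrier (KdV_algebra n)"
      note D = this[THEN KdV_algebraD(4)]
      show "A \<otimes>\<^bsub>KdV_algebra n\<^esub> A = \<zero>\<^bsub>KdV_algebra n\<^esub>"
        unfolding KdV_algebra_simps by (rule restrict_ext) (rule commutator_identities(5)[OF D D D])
    qed (use closed in auto)
  qed
qed

section \<open>Subalgebras cut out by vanishing Fourier coefficients\<close>

definition coeffs_vanish :: "nat \<Rightarrow> int set \<Rightarrow> (complex \<Rightarrow> complex mat) \<Rightarrow> bool" where
  "coeffs_vanish n I A \<longleftrightarrow> (\<forall>i\<in>I. \<forall>a<n. \<forall>b<n. fourier_coeff (\<lambda>z. A z $$ (a, b)) i = 0)"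

lemma loop_coeff_eq_zero_iff:
  "loop_coeff n A i = 0\<^sub>m n n \<longleftrightarrow> (\<forall>a<n. \<forall>b<n. fourier_coeff (\<lambda>z. A z $$ (a, b)) i = 0)"
  unfolding loop_coeff_eq by (auto simp: mat_eq_iff)

text \<open>Together with its counterpart for \<open>{0..}\<close>, this presents both halves as
  instances of one construction, so that closure is proved once for a general index set.\<close>

lemma KdV_algebra_plus_eq:
  "KdV_algebra_plus n = {A \<in> carrier (KdV_algebra n). coeffs_vanish n {..<0} A}"
  by (auto simp: KdV_algebra_plus_def loop_sl_plus_def KdV_algebra_simps(1) coeffs_vanish_def
      loop_coeff_eq_zero_iff)

lemma KdV_algebra_minus_eq:
  "KdV_algebra_minus n = {A \<in> carrier (KdV_algebra n). coeffs_vanish n {0..} A}"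
  by (auto simp: KdV_algebra_minus_def loop_sl_minus_def KdV_algebra_simps(1) coeffs_vanish_def
      loop_coeff_eq_zero_iff)

lemma fourier_coeff_sum:
  assumes "\<And>k. k \<in> K \<Longrightarrow> smooth_on_circle (f k)"
  shows "fourier_coeff (\<lambda>z. \<Sum>k\<in>K. f k z) i = (\<Sum>k\<in>K. fourier_coeff (f k) i)"
  using assms
proof (induction K rule: infinite_finite_induct)
  case (insert k K)
  have "smooth_on_circle (\<lambda>z. \<Sum>k\<in>K. f k z)"
    using smooth.sum[of K f] insert.prems by simp
  then have "fourier_coeff (\<lambda>z. f k z + (\<Sum>k\<in>K. f k z)) i =
      fourier_coeff (f k) i + fourier_coeff (\<lambda>z. \<Sum>k\<in>K. f k z) i"
    using insert.prems[of k] by (intro fourier_coeff_add smooth_on_circle_imp_continuous_on) simp_all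
  then show ?case
    using insert by simp
qed (simp_all add: fourier_coeff_const)

lemma smooth_entry:
  "\<lbrakk>A \<in> smooth.matrices n; a < n; b < n\<rbrakk> \<Longrightarrow> smooth_on_circle (\<lambda>z. A z $$ (a, b))"
  using smooth.matrices_entry by simp

lemma coeffs_vanish_zero: "coeffs_vanish n I \<zero>\<^bsub>KdV_algebra n\<^esub>"
  unfolding coeffs_vanish_def
proof (intro ballI allI impI)
  fix i a b assume "a < n" "b < n"
  then have "fourier_coeff (\<lambda>z. \<zero>\<^bsub>KdV_algebra n\<^esub> z $$ (a, b)) i = fourier_coeff (\<lambda>_. 0) i"
    by (intro fourier_coeff_cong) (simp add: KdV_algebra_simps(3))
  then show "fourier_coeff (\<lambda>z. \<zero>\<^bsub>KdV_algebra n\<^esub> z $$ (a, b)) i = 0"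
    by (simp add: fourier_coeff_const)
qed

lemma coeffs_vanish_add:
  assumes AB: "A \<in> smooth.matrices n" "B \<in> smooth.matrices n"
    and v: "coeffs_vanish n I A" "coeffs_vanish n I B"
  shows "coeffs_vanish n I (\<lambda>z\<in>circle. A z + B z)"
  unfolding coeffs_vanish_def
proof (intro ballI allI impI)
  fix i a b assume i: "i \<in> I" and ab: "a < n" "b < n"
  have "fourier_coeff (\<lambda>z. (\<lambda>z\<in>circle. A z + B z) z $$ (a, b)) i =
      fourier_coeff (\<lambda>z. A z $$ (a, b) + B z $$ (a, b)) i"
    using ab by (intro fourier_coeff_cong)
      (simp add: AB[THEN smooth.matrices_carrier, THEN carrier_matD(1)]
        AB[THEN smooth.matrices_carrier, THEN carrier_matD(2)])
  also have "\<dots> = fourier_coeff (\<lambda>z. A z $$ (a, b)) i + fourier_coeff (\<lambda>z. B z $$ (a, b)) i"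
    by (intro fourier_coeff_add smooth_on_circle_imp_continuous_on smooth_entry[OF _ ab] AB)
  finally show "fourier_coeff (\<lambda>z. (\<lambda>z\<in>circle. A z + B z) z $$ (a, b)) i = 0"
    using v i ab by (simp add: coeffs_vanish_def)
qed

lemma coeffs_vanish_smult:
  assumes A: "A \<in> smooth.matrices n" and v: "coeffs_vanish n I A"
  shows "coeffs_vanish n I (\<lambda>z\<in>circle. c \<cdot>\<^sub>m A z)"
  unfolding coeffs_vanish_def
proof (intro ballI allI impI)
  fix i a b assume i: "i \<in> I" and ab: "a < n" "b < n"
  have "fourier_coeff (\<lambda>z. (\<lambda>z\<in>circle. c \<cdot>\<^sub>m A z) z $$ (a, b)) i =
      fourier_coeff (\<lambda>z. c * A z $$ (a, b)) i"
    using ab by (intro fourier_coeff_cong) (simp add: carrier_matD[OF smooth.matrices_carrier[OF A]])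
  then show "fourier_coeff (\<lambda>z. (\<lambda>z\<in>circle. c \<cdot>\<^sub>m A z) z $$ (a, b)) i = 0"
    using v i ab by (simp add: coeffs_vanish_def fourier_coeff_cmult)
qed

text \<open>Assumption \<open>I\<close> says that scalar functions whose coefficients vanish on the
  index set are closed under multiplication. Entries of the commutator are differences of sums of
  such products.\<close>

lemma coeffs_vanish_commutator:
  assumes AB: "A \<in> smooth.matrices n" "B \<in> smooth.matrices n"
    and v: "coeffs_vanish n I A" "coeffs_vanish n I B"
    and I: "\<And>f g i. \<lbrakk>smooth_on_circle f; smooth_on_circle g; \<And>i. i \<in> I \<Longrightarrow> fourier_coeff f i = 0;
      \<And>i. i \<in> I \<Longrightarrow> fourier_coeff g i = 0; i \<in> I\<rbrakk> \<Longrightarrow> fourier_coeff (\<lambda>z. f z * g z) i = 0"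
  shows "coeffs_vanish n I (\<lambda>z\<in>circle. A z * B z - B z * A z)"
  unfolding coeffs_vanish_def
proof (intro ballI allI impI)
  fix i a b assume i: "i \<in> I" and ab: "a < n" "b < n"
  note entry = smooth_entry[OF AB(1)] smooth_entry[OF AB(2)]
  have prod: "fourier_coeff (\<lambda>z. A z $$ (a, k) * B z $$ (k, b)) i = 0"
    "fourier_coeff (\<lambda>z. B z $$ (a, k) * A z $$ (k, b)) i = 0" if "k < n" for k
    using v ab that by (intro I entry i; simp add: coeffs_vanish_def)+
  have smooth: "smooth_on_circle (\<lambda>z. A z $$ (a, k) * B z $$ (k, b))"
    "smooth_on_circle (\<lambda>z. B z $$ (a, k) * A z $$ (k, b))" if "k \<in> {0..<n}" for k
    using that ab by (auto intro!: smooth_on_circle_mult entry)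
  have "fourier_coeff (\<lambda>z. (\<lambda>z\<in>circle. A z * B z - B z * A z) z $$ (a, b)) i =
      fourier_coeff (\<lambda>z. (\<Sum>k\<in>{0..<n}. A z $$ (a, k) * B z $$ (k, b)) -
        (\<Sum>k\<in>{0..<n}. B z $$ (a, k) * A z $$ (k, b))) i"
    using ab by (intro fourier_coeff_cong)
      (simp add: scalar_prod_def AB[THEN smooth.matrices_carrier, THEN carrier_matD(1)]
        AB[THEN smooth.matrices_carrier, THEN carrier_matD(2)])
  also have "\<dots> = fourier_coeff (\<lambda>z. \<Sum>k\<in>{0..<n}. A z $$ (a, k) * B z $$ (k, b)) i -
      fourier_coeff (\<lambda>z. \<Sum>k\<in>{0..<n}. B z $$ (a, k) * A z $$ (k, b)) i"
    using smooth.sum[of "{0..<n}" "\<lambda>k z. A z $$ (a, k) * B z $$ (k, b)"]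
      smooth.sum[of "{0..<n}" "\<lambda>k z. B z $$ (a, k) * A z $$ (k, b)"] smooth
    by (intro fourier_coeff_diff smooth_on_circle_imp_continuous_on) simp_all
  also have "\<dots> = 0"
    using prod smooth fourier_coeff_sum[of "{0..<n}" "\<lambda>k z. A z $$ (a, k) * B z $$ (k, b)" i]
      fourier_coeff_sum[of "{0..<n}" "\<lambda>k z. B z $$ (a, k) * A z $$ (k, b)" i]
    by simp
  finally show "fourier_coeff (\<lambda>z. (\<lambda>z\<in>circle. A z * B z - B z * A z) z $$ (a, b)) i = 0" .
qed

lemma lie_subalgebra_coeffs_vanish:
  assumes n: "n \<ge> 2"
    and I: "\<And>f g i. \<lbrakk>smooth_on_circle f; smooth_on_circle g; \<And>i. i \<in> I \<Longrightarrow> fourier_coeff f i = 0;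
      \<And>i. i \<in> I \<Longrightarrow> fourier_coeff g i = 0; i \<in> I\<rbrakk> \<Longrightarrow> fourier_coeff (\<lambda>z. f z * g z) i = 0"
  shows "lie_subalgebra {A \<in> carrier (KdV_algebra n). coeffs_vanish n I A} complex_ring (KdV_algebra n)"
proof -
  interpret L: lie_algebra complex_ring "KdV_algebra n"
    by (rule lie_algebra_KdV[OF n])
  let ?H = "{A \<in> carrier (KdV_algebra n). coeffs_vanish n I A}"
  have smult: "a \<odot>\<^bsub>KdV_algebra n\<^esub> A \<in> ?H" if "A \<in> ?H" for a A
    using that KdV_algebra_smult_closed[OF n] KdV_algebraD(1)[of A n]
    by (simp add: KdV_algebra_simps(5) coeffs_vanish_smult)
  have "submodule ?H complex_ring (KdV_algebra n)"
  proof (rule L.submoduleI)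
    show "\<zero>\<^bsub>KdV_algebra n\<^esub> \<in> ?H"
      using KdV_algebra_zero_closed[OF n] coeffs_vanish_zero by simp
  next
    fix A assume A: "A \<in> ?H"
    \<comment> \<open>Negation is multiplication by the scalar -1, so closure under scalars
      suffices.\<close>
    have "\<ominus>\<^bsub>KdV_algebra n\<^esub> A = (\<ominus>\<^bsub>complex_ring\<^esub> \<one>\<^bsub>complex_ring\<^esub>) \<odot>\<^bsub>KdV_algebra n\<^esub> A"
      using A by (simp add: L.smult_l_minus)
    then show "\<ominus>\<^bsub>KdV_algebra n\<^esub> A \<in> ?H"
      using smult[OF A] by simp
  next
    fix A B assume "A \<in> ?H" "B \<in> ?H"
    then show "A \<oplus>\<^bsub>KdV_algebra n\<^esub> B \<in> ?H"
      using KdV_algebra_add_closed[OF n, of A B] KdV_algebraD(1)[of A n] KdV_algebraD(1)[of B n]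
      by (simp add: KdV_algebra_simps(4) coeffs_vanish_add)
  qed (use smult in auto)
  moreover have "A \<otimes>\<^bsub>KdV_algebra n\<^esub> B \<in> ?H" if "A \<in> ?H" "B \<in> ?H" for A B
  proof -
    have A: "A \<in> carrier (KdV_algebra n)" "coeffs_vanish n I A"
      and B: "B \<in> carrier (KdV_algebra n)" "coeffs_vanish n I B"
      using that by simp_all
    have "coeffs_vanish n I (A \<otimes>\<^bsub>KdV_algebra n\<^esub> B)"
      unfolding KdV_algebra_simps(2)
      by (rule coeffs_vanish_commutator[OF KdV_algebraD(1)[OF A(1)] KdV_algebraD(1)[OF B(1)] A(2) B(2)])
         (rule I)
    then show ?thesis
      using KdV_algebra_bracket_closed[OF n A(1) B(1)] by simp
  qed
  ultimately show ?thesis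
    by (simp add: lie_subalgebra_def)
qed

lemma KdV_algebra_plus_Int_minus:
  assumes n: "n \<ge> 2"
  shows "KdV_algebra_plus n \<inter> KdV_algebra_minus n = {\<zero>\<^bsub>KdV_algebra n\<^esub>}"
proof (intro equalityI subsetI)
  fix A assume "A \<in> KdV_algebra_plus n \<inter> KdV_algebra_minus n"
  then have A: "A \<in> carrier (KdV_algebra n)" and "coeffs_vanish n {..<0} A" "coeffs_vanish n {0..} A"
    by (auto simp: KdV_algebra_plus_eq KdV_algebra_minus_eq)
  then have c: "fourier_coeff (\<lambda>z. A z $$ (a, b)) i = 0" if "a < n" "b < n" for a b i
    using that by (cases "i < 0") (auto simp: coeffs_vanish_def)
  have "A z $$ (a, b) = 0" if "z \<in> circle" "a < n" "b < n" for z a b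
    by (rule fourier_coeff_unique[where f = "\<lambda>z. A z $$ (a, b)", OF _ c[OF that(2,3)] that(1)])
       (intro smooth_on_circle_imp_continuous_on smooth_entry[OF KdV_algebraD(1)[OF A] that(2,3)])
  then have "A z = 0\<^sub>m n n" if "z \<in> circle" for z
    using KdV_algebraD(4)[OF A that] that by (intro eq_matI) auto
  then have "A = (\<lambda>z\<in>circle. 0\<^sub>m n n)"
    using KdV_algebraD(2)[OF A] by (intro extensionalityI[of _ circle]) auto
  then show "A \<in> {\<zero>\<^bsub>KdV_algebra n\<^esub>}"
    by (simp add: KdV_algebra_simps(3))
next
  fix A assume "A \<in> {\<zero>\<^bsub>KdV_algebra n\<^esub>}"
  then show "A \<in> KdV_algebra_plus n \<inter> KdV_algebra_minus n"
    using KdV_algebra_zero_closed[OF n] coeffs_vanish_zero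
    by (simp add: KdV_algebra_plus_eq KdV_algebra_minus_eq)
qed

section \<open>The projection onto nonnegative powers and the decomposition\<close>

definition loop_plus :: "nat \<Rightarrow> (complex \<Rightarrow> complex mat) \<Rightarrow> complex \<Rightarrow> complex mat" where
  "loop_plus n A = (\<lambda>z\<in>circle. mat n n (\<lambda>(i, j). fourier_plus (\<lambda>z. A z $$ (i, j)) z))"

text \<open>Entrywise, the reality condition reads \<open>u(z) = z v(z)\<close> with \<open>u\<close>, \<open>v\<close> linear in \<open>A\<close> and \<open>A(\<alpha>z)\<close>
  and the zeroth coefficient of \<open>u\<close> equal to zero. This is why truncating the Fourier series
  at index 0 preserves it.\<close>

lemma kdv_reality_loop_plus:
  assumes n: "n \<ge> 2" and A: "A \<in> smooth.matrices n" and real: "kdv_reality n A"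
  shows "kdv_reality n (loop_plus n A)"
proof -
  define \<alpha> where "\<alpha> = kdv_alpha n"
  have s: "0 \<le> 2 * pi / n" "2 * pi / n \<le> 2 * pi" "\<alpha> = cis (2 * pi / n)"
    using n by (simp_all add: \<alpha>_def kdv_alpha_cis field_simps)
  have \<alpha>: "\<alpha> \<in> circle"
    by (simp add: s)
  have "loop_plus n A (\<alpha> * z) $$ (i, j) - loop_plus n A z $$ (i, j) =
      z * ((1 - \<alpha> ^ i) * loop_plus n A (\<alpha> * z) $$ (i - 1, j) -
        (1 - \<alpha> ^ Suc j) * loop_plus n A z $$ (i, Suc j mod n))"
    if ij: "i < n" "j < n" and z: "z \<in> circle" for i j z
  proof -
    have ij': "i - 1 < n" "Suc j mod n < n"
      using ij by auto
    have \<alpha>z: "\<alpha> * z \<in> circle"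
      using \<alpha> z by (simp add: norm_mult)
    define a where "a k l w = A w $$ (k, l)" for k l w
    have sm: "smooth_on_circle (a k l)" "smooth_on_circle (\<lambda>w. a k l (\<alpha> * w))" if "k < n" "l < n" for k l
      using smooth_entry[OF A that] smooth_on_circle_rotate[OF smooth_entry[OF A that] \<alpha>]
      by (simp_all add: a_def[abs_def])
    have rot: "fourier_plus (\<lambda>w. a k l (\<alpha> * w)) z = fourier_plus (a k l) (\<alpha> * z)"
      if "k < n" "l < n" for k l
      unfolding s(3) by (rule fourier_plus_rotate[OF smooth_on_circle_imp_continuous_on[OF sm(1)[OF that]] s(1,2)])
    have entry: "loop_plus n A w $$ (k, l) = fourier_plus (a k l) w"
      if "k < n" "l < n" "w \<in> circle" for k l w
      using that by (simp add: loop_plus_def a_def[abs_def])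
    define u where "u w = a i j (\<alpha> * w) - a i j w" for w
    define v where "v w = (1 - \<alpha> ^ i) * a (i - 1) j (\<alpha> * w) - (1 - \<alpha> ^ Suc j) * a i (Suc j mod n) w" for w
    have v: "smooth_on_circle v"
      unfolding v_def[abs_def]
      by (intro smooth_on_circle_diff smooth_on_circle_mult smooth_on_circle_const sm ij ij')
    have uv: "u w = w * v w" if "w \<in> circle" for w
      using real that ij kdv_reality_iff_entries[OF n, of A] smooth.matrices_carrier[OF A]
      unfolding u_def v_def a_def \<alpha>_def by blast
    \<comment> \<open>Rotation by \<alpha> multiplies the k-th coefficient by the k-th power of
      \<alpha>. At k = 0 this factor is 1, so the two terms of u cancel; equivalently, v has no
      coefficient at -1.\<close>
    have "fourier_coeff u 0 = 0"
      using smooth_on_circle_imp_continuous_on[OF sm(1)[OF ij]]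
        smooth_on_circle_imp_continuous_on[OF sm(2)[OF ij]] fourier_coeff_rotate[OF _ s(1,2), of "a i j" 0]
      by (simp add: u_def[abs_def] fourier_coeff_diff s(3))
    then have "fourier_plus u z = z * fourier_plus v z"
      by (intro fourier_plus_shift[where f = u and g = v] v z uv)
    moreover have "fourier_plus u z = fourier_plus (a i j) (\<alpha> * z) - fourier_plus (a i j) z"
      unfolding u_def[abs_def] fourier_plus_diff[OF sm(2)[OF ij] sm(1)[OF ij] z] rot[OF ij] ..
    moreover have "fourier_plus v z = (1 - \<alpha> ^ i) * fourier_plus (a (i - 1) j) (\<alpha> * z) -
        (1 - \<alpha> ^ Suc j) * fourier_plus (a i (Suc j mod n)) z"
    proof -
      note sm1 = sm(2)[OF ij'(1) ij(2)] and sm2 = sm(1)[OF ij(1) ij'(2)]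
      show ?thesis
        unfolding v_def[abs_def]
          fourier_plus_diff[OF smooth_on_circle_mult[OF smooth_on_circle_const sm1]
            smooth_on_circle_mult[OF smooth_on_circle_const sm2] z]
          fourier_plus_cmult[OF sm1 z] fourier_plus_cmult[OF sm2 z] rot[OF ij'(1) ij(2)] ..
    qed
    ultimately show ?thesis
      using entry ij ij' z \<alpha>z by simp
  qed
  then show ?thesis
    unfolding \<alpha>_def by (subst kdv_reality_iff_entries[OF n]) (simp_all add: loop_plus_def)
qed

lemma loop_plus_mem:
  assumes n: "n \<ge> 2" and A: "A \<in> carrier (KdV_algebra n)"
  shows "loop_plus n A \<in> carrier (KdV_algebra n)"
proof -
  note AD = KdV_algebraD[OF A]
  define F where "F z = mat n n (\<lambda>(i, j). fourier_plus (\<lambda>z. A z $$ (i, j)) z)" for z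
  have F: "loop_plus n A = restrict F circle"
    by (simp add: loop_plus_def F_def[abs_def])
  have "F \<in> smooth.matrices n"
  proof (rule smooth.matricesI[where a = "\<lambda>i j. fourier_plus (\<lambda>z. A z $$ (i, j))"])
    show "fourier_plus (\<lambda>z. A z $$ (i, j)) \<in> {g. smooth_on_circle g}" if "i < n" "j < n" for i j
      using smooth_fourier_plus[OF smooth_entry[OF AD(1) that]] by simp
  qed (simp_all add: F_def)
  moreover have "mat_trace (F z) = 0" if z: "z \<in> circle" for z
  proof -
    have "mat_trace (F z) = (\<Sum>i<n. fourier_plus (\<lambda>z. A z $$ (i, i)) z)"
      by (simp add: mat_trace_def F_def)
    \<comment> \<open>The projection is linear, so it commutes with the trace and preserves trace
      zero.\<close>
    also have "\<dots> = fourier_plus (\<lambda>z. \<Sum>i<n. A z $$ (i, i)) z"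
      using smooth_entry[OF AD(1)] z by (intro fourier_plus_sum[symmetric]) auto
    also have "\<dots> = fourier_plus (\<lambda>_. 0) z"
    proof -
      have "(\<Sum>i<n. A z $$ (i, i)) = 0" if "z \<in> circle" for z
        using AD(4,5)[OF that] by (simp add: mat_trace_def)
      from fourier_coeff_cong[OF this] show ?thesis
        by (simp add: fourier_plus_def)
    qed
    also have "\<dots> = 0"
      by (simp add: fourier_plus_def fourier_coeff_const)
    finally show ?thesis .
  qed
  moreover have "kdv_reality n F"
    using kdv_reality_loop_plus[OF n AD(1,3)] by (simp add: F kdv_reality_restrict)
  ultimately show ?thesis
    unfolding F by (rule KdV_algebraI)
qed

lemma fourier_coeff_loop_plus:
  assumes "A \<in> smooth.matrices n" "a < n" "b < n"
  shows "fourier_coeff (\<lambda>z. loop_plus n A z $$ (a, b)) i =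
    (if i \<ge> 0 then fourier_coeff (\<lambda>z. A z $$ (a, b)) i else 0)"
proof -
  have "fourier_coeff (\<lambda>z. loop_plus n A z $$ (a, b)) i =
      fourier_coeff (fourier_plus (\<lambda>z. A z $$ (a, b))) i"
    using assms by (intro fourier_coeff_cong) (simp add: loop_plus_def)
  then show ?thesis
    by (simp add: fourier_coeff_fourier_plus smooth_entry[OF assms])
qed

text \<open>Only one projection is constructed. The negative part is the difference A - P, which
  satisfies the reality condition by linearity.\<close>

lemma KdV_algebra_decomposition:
  assumes n: "n \<ge> 2"
  shows "carrier (KdV_algebra n) = set_add (KdV_algebra n) (KdV_algebra_plus n) (KdV_algebra_minus n)"
proof (intro equalityI subsetI)
  fix A assume A: "A \<in> carrier (KdV_algebra n)"
  define P where "P = loop_plus n A"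
  define M where "M = A \<oplus>\<^bsub>KdV_algebra n\<^esub> ((- 1) \<odot>\<^bsub>KdV_algebra n\<^esub> P)"
  have P: "P \<in> carrier (KdV_algebra n)"
    unfolding P_def by (rule loop_plus_mem[OF n A])
  have M: "M \<in> carrier (KdV_algebra n)"
    unfolding M_def
    by (rule KdV_algebra_add_closed[OF n A KdV_algebra_smult_closed[OF n P]])
  note AD = KdV_algebraD[OF A] and PD = KdV_algebraD[OF P]
  have "P \<in> KdV_algebra_plus n"
    using P by (simp add: KdV_algebra_plus_eq coeffs_vanish_def P_def fourier_coeff_loop_plus[OF AD(1)])
  moreover have "M \<in> KdV_algebra_minus n"
  proof -
    have "fourier_coeff (\<lambda>z. M z $$ (a, b)) i = 0" if i: "i \<ge> 0" and ab: "a < n" "b < n" for i a b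
    proof -
      have "fourier_coeff (\<lambda>z. M z $$ (a, b)) i = fourier_coeff (\<lambda>z. A z $$ (a, b) - P z $$ (a, b)) i"
        using ab by (intro fourier_coeff_cong)
          (simp add: M_def KdV_algebra_simps carrier_matD[OF AD(4)] carrier_matD[OF PD(4)])
      also have "\<dots> = fourier_coeff (\<lambda>z. A z $$ (a, b)) i - fourier_coeff (\<lambda>z. P z $$ (a, b)) i"
        by (intro fourier_coeff_diff smooth_on_circle_imp_continuous_on smooth_entry[OF _ ab] AD(1) PD(1))
      also have "\<dots> = 0"
        using i by (simp add: P_def fourier_coeff_loop_plus[OF AD(1) ab])
      finally show ?thesis .
    qed
    then show ?thesis
      using M by (simp add: KdV_algebra_minus_eq coeffs_vanish_def)
  qed
  moreover have "A = P \<oplus>\<^bsub>KdV_algebra n\<^esub> M"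
  proof (rule extensionalityI[OF AD(2)])
    show "P \<oplus>\<^bsub>KdV_algebra n\<^esub> M \<in> extensional circle"
      by (simp add: KdV_algebra_simps)
    show "A z = (P \<oplus>\<^bsub>KdV_algebra n\<^esub> M) z" if "z \<in> circle" for z
      using that
      by (intro eq_matI) (simp_all add: M_def KdV_algebra_simps carrier_matD[OF AD(4)] carrier_matD[OF PD(4)])
  qed
  ultimately show "A \<in> set_add (KdV_algebra n) (KdV_algebra_plus n) (KdV_algebra_minus n)"
    unfolding set_add_def' by blast
next
  fix A assume "A \<in> set_add (KdV_algebra n) (KdV_algebra_plus n) (KdV_algebra_minus n)"
  then obtain P M where "P \<in> KdV_algebra_plus n" "M \<in> KdV_algebra_minus n" "A = P \<oplus>\<^bsub>KdV_algebra n\<^esub> M"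
    unfolding set_add_def' by blast
  then show "A \<in> carrier (KdV_algebra n)"
    using KdV_algebra_add_closed[OF n] by (simp add: KdV_algebra_plus_eq KdV_algebra_minus_eq)
qed

theorem theorem2p5:
  fixes n :: nat
  assumes "n \<ge> 2"
  shows "splitting complex_ring
           (KdV_group n) (KdV_group_plus n) (KdV_group_minus n)
           (KdV_algebra n) (KdV_algebra_plus n) (KdV_algebra_minus n)"
  unfolding splitting_def
proof (intro conjI)
  show "subgroup (KdV_group_plus n) (KdV_group n)" "subgroup (KdV_group_minus n) (KdV_group n)"
    unfolding KdV_group_plus_def KdV_group_minus_def
    by (intro subgroup_KdV_Int[OF assms] subgroup_loop_SL_plus subgroup_loop_SL_minus)+
  show "lie_subalgebra (KdV_algebra_plus n) complex_ring (KdV_algebra n)"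
    unfolding KdV_algebra_plus_eq
    by (rule lie_subalgebra_coeffs_vanish[OF assms]) (simp add: fourier_coeff_mult_eq_0[where m = 0])
  show "lie_subalgebra (KdV_algebra_minus n) complex_ring (KdV_algebra n)"
    unfolding KdV_algebra_minus_eq
    by (rule lie_subalgebra_coeffs_vanish[OF assms]) (simp add: fourier_coeff_mult_eq_0')
  \<comment> \<open>The intersection is known in the ambient loop group; restricting it keeps the
    unit because the unit satisfies the reality condition.\<close>
  have "\<one>\<^bsub>loop_SL n\<^esub> \<in> carrier (KdV_group n)"
    by (rule subgroup.one_closed[OF subgroup_KdV[OF assms]])
  then show "KdV_group_plus n \<inter> KdV_group_minus n = {\<one>\<^bsub>KdV_group n\<^esub>}"
    using loop_SL_plus_Int_minus[of n]
    by (auto simp: KdV_group_plus_def KdV_group_minus_def KdV_group_def)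
qed (use assms in \<open>simp_all add: group_KdV lie_algebra_KdV KdV_algebra_decomposition KdV_algebra_plus_Int_minus\<close>)

end
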